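(* Let $N$ be an $n$-dimensional Riemannian manifold, let $r:N\to\mathbb{R}$ be an isoparametric function on $N$, with $C^\infty$ functions $\alpha,\beta$ satisfying $\|\nabla r\|^2=\alpha\circ r$ and $\Delta r=\beta\circ r$. Let $M\subset N$ be a domain, $u:M\to\mathbb{R}$ a function, and $\Gamma$ the graph of $u$ in $N\times\mathbb{R}$. If the mean curvature flow starting from $\Gamma$ is a translating soliton and if there exists a $C^\infty$ function $V$ on $r(M)$ such that $u=(V\circ r)|_M$, then $V$ satisfies $$2\alpha V''-\alpha(\alpha'-2\beta)V'^3-2\alpha V'^2+2\beta V'-2=0$$ on $r(M)$, where $'$ denotes the derivative on $r(M)$. Conversely, if a $C^\infty$ function $V$ on $r(M)$ satisfies this equation, then the family of images $\{M_t\}_{t\in\mathbb{R}}$ defined by $f_t(x)=(x,(V\circ r)(x)+t)$, $x\in M$, and $M_t=f_t(M)$ is a translating soliton.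
   Context: A non-constant $C^\infty$ function $r:N\to\mathbb{R}$ is isoparametric if there exist $C^\infty$ functions $\alpha,\beta$ with $\|\nabla r\|^2=\alpha\circ r$ and $\Delta r=\beta\circ r$ ($\nabla$, $\Delta$ the gradient and Laplacian of $N$). For a function $u$ on a domain $M\subset N$, let $f(x)=(x,u(x))$ be the graph immersion into the product Riemannian manifold $N\times\mathbb{R}$. A smooth family of immersions $f_t:M\to N\times\mathbb{R}$, $t\in I$ ($I$ an open interval containing $0$), with $f_0=f$ and $(\partial f_t/\partial t)^{\bot_{f_t}}=H_t$ (here $(\cdot)^{\bot_{f_t}}$ is the normal component and $H_t$ the mean curvature vector field of $f_t$) gives, with $M_t=f_t(M)$, the mean curvature flow $\{M_t\}$ starting from the graph. It is a translating soliton if $\tilde f_t=\phi_t^{-1}\circ f_t$ satisfies $(\partial\tilde f_t/\partial t)^{\bot_{\tilde f_t}}=0$, where $\phi_t(x,s)=(x,s+t)$ is the one-parameter group of the Killing field $X=(0,1)\in TN\oplus T\mathbb{R}$. *)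

theory Defs
  imports "HOL-Analysis.Analysis"
begin

section \<open>Smooth functions\<close>

text \<open>Meant for open sets \<open>S\<close> and finite-dimensional domains: all iterated directional
  derivatives up to order \<open>k\<close> exist and are continuous.\<close>

primrec Ck_on :: "nat \<Rightarrow> 'a::real_normed_vector set \<Rightarrow> ('a \<Rightarrow> 'b::real_normed_vector) \<Rightarrow> bool" where
  "Ck_on 0 S f \<longleftrightarrow> continuous_on S f"
| "Ck_on (Suc k) S f \<longleftrightarrow>
     (\<forall>x\<in>S. f differentiable (at x)) \<and> (\<forall>v. Ck_on k S (\<lambda>x. frechet_derivative f (at x) v))"

definition smooth_on :: "'a::real_normed_vector set \<Rightarrow> ('a \<Rightarrow> 'b::real_normed_vector) \<Rightarrow> bool" where
  "smooth_on S f \<longleftrightarrow> (\<forall>k. Ck_on k S f)"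

text \<open>Smoothness on a set of reals that need not be open, such as the range of a function.\<close>

definition smooth_on_set :: "real set \<Rightarrow> (real \<Rightarrow> real) \<Rightarrow> bool" where
  "smooth_on_set J V \<longleftrightarrow> (\<exists>U W. open U \<and> J \<subseteq> U \<and> smooth_on U W \<and> (\<forall>s\<in>J. W s = V s))"

text \<open>One-sided at the end points that belong to \<open>J\<close>.\<close>

definition deriv_on :: "real set \<Rightarrow> (real \<Rightarrow> real) \<Rightarrow> real \<Rightarrow> real" where
  "deriv_on J V s = vector_derivative V (at s within J)"

definition dir_deriv2 ::
  "('a::real_normed_vector \<Rightarrow> 'b::real_normed_vector) \<Rightarrow> 'a \<Rightarrow> 'a \<Rightarrow> 'a \<Rightarrow> 'b" where
  "dir_deriv2 f y v w = frechet_derivative (\<lambda>z. frechet_derivative f (at z) w) (at y) v"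


section \<open>Inner products on the model space\<close>

definition inner_product :: "('e::real_vector \<Rightarrow> 'e \<Rightarrow> real) \<Rightarrow> bool" where
  "inner_product G \<longleftrightarrow> bilinear G \<and> (\<forall>v w. G v w = G w v) \<and> (\<forall>v. v \<noteq> 0 \<longrightarrow> 0 < G v v)"

definition sharp :: "('e \<Rightarrow> 'e \<Rightarrow> real) \<Rightarrow> ('e \<Rightarrow> real) \<Rightarrow> 'e" where
  "sharp G l = (THE v. \<forall>w. G v w = l w)"

text \<open>In the coordinates given by \<open>Basis\<close> this is $\sum_{i,j} G^{ij} B_{ij}$: the vector
  \<open>sharp G (\<lambda>w. b \<bullet> w)\<close> is the row of the inverse matrix $(G^{ij})$ belonging to \<open>b\<close>.\<close>

definition metric_trace ::
  "('e::euclidean_space \<Rightarrow> 'e \<Rightarrow> real) \<Rightarrow> ('e \<Rightarrow> 'e \<Rightarrow> 'f::real_vector) \<Rightarrow> 'f" where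
  "metric_trace G B = (\<Sum>b\<in>Basis. B b (sharp G (\<lambda>w. b \<bullet> w)))"

text \<open>The component of \<open>w\<close> that is \<open>G\<close>-orthogonal to the range of the linear map \<open>A\<close>.\<close>

definition normal_part ::
  "('f::real_vector \<Rightarrow> 'f \<Rightarrow> real) \<Rightarrow> ('e \<Rightarrow> 'f) \<Rightarrow> 'f \<Rightarrow> 'f" where
  "normal_part G A w = (THE n. w - n \<in> range A \<and> (\<forall>v. G n (A v) = 0))"


section \<open>Riemannian manifolds\<close>

text \<open>A manifold is the whole of the topological space \<open>'a\<close>, with an atlas indexed by \<open>'i\<close> whose
  charts take values in \<open>'e\<close>; its dimension is \<open>DIM('e)\<close>. Tensors are given by their local
  representations: \<open>metric N i y v w\<close> is the inner product of the tangent vectors at the point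
  with coordinates \<open>y\<close> whose components in chart \<open>i\<close> are \<open>v\<close> and \<open>w\<close>.\<close>

record ('i, 'a, 'e) riem =
  chart_dom :: "'i \<Rightarrow> 'a set"
  chart :: "'i \<Rightarrow> 'a \<Rightarrow> 'e"
  metric :: "'i \<Rightarrow> 'e \<Rightarrow> 'e \<Rightarrow> 'e \<Rightarrow> real"

definition cinv :: "('i, 'a, 'e) riem \<Rightarrow> 'i \<Rightarrow> 'e \<Rightarrow> 'a" where
  "cinv N i = inv_into (chart_dom N i) (chart N i)"

definition transition :: "('i, 'a, 'e) riem \<Rightarrow> 'i \<Rightarrow> 'i \<Rightarrow> 'e \<Rightarrow> 'e" where
  "transition N i j = chart N j \<circ> cinv N i"

definition riemannian_manifold ::
  "('i, 'a::{t2_space, second_countable_topology}, 'e::euclidean_space) riem \<Rightarrow> bool" where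
  "riemannian_manifold N \<longleftrightarrow>
     (\<Union>i. chart_dom N i) = UNIV \<and>
     (\<forall>i. open (chart_dom N i) \<and> open (chart N i ` chart_dom N i) \<and>
          homeomorphism (chart_dom N i) (chart N i ` chart_dom N i) (chart N i) (cinv N i)) \<and>
     (\<forall>i j. smooth_on (chart N i ` (chart_dom N i \<inter> chart_dom N j)) (transition N i j)) \<and>
     (\<forall>i. \<forall>y \<in> chart N i ` chart_dom N i. inner_product (metric N i y)) \<and>
     (\<forall>i v w. smooth_on (chart N i ` chart_dom N i) (\<lambda>y. metric N i y v w)) \<and>
     (\<forall>i j. \<forall>y \<in> chart N i ` (chart_dom N i \<inter> chart_dom N j). \<forall>v w.
        metric N i y v w =
        metric N j (transition N i j y)
          (frechet_derivative (transition N i j) (at y) v)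
          (frechet_derivative (transition N i j) (at y) w))"

text \<open>Koszul formula for the Levi-Civita connection in chart \<open>i\<close>:
  \<open>christoffel N i y v w\<close> is the vector with components $\Gamma^c_{ab} v^a w^b$.\<close>

definition christoffel ::
  "('i, 'a, 'e::euclidean_space) riem \<Rightarrow> 'i \<Rightarrow> 'e \<Rightarrow> 'e \<Rightarrow> 'e \<Rightarrow> 'e" where
  "christoffel N i y v w = sharp (metric N i y) (\<lambda>z.
     (frechet_derivative (\<lambda>p. metric N i p w z) (at y) v
      + frechet_derivative (\<lambda>p. metric N i p v z) (at y) w
      - frechet_derivative (\<lambda>p. metric N i p v w) (at y) z) / 2)"

definition smooth_fun :: "('i, 'a, 'e::euclidean_space) riem \<Rightarrow> ('a \<Rightarrow> real) \<Rightarrow> bool" where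
  "smooth_fun N r \<longleftrightarrow> (\<forall>i. smooth_on (chart N i ` chart_dom N i) (r \<circ> cinv N i))"

definition gradient :: "('i, 'a, 'e::euclidean_space) riem \<Rightarrow> ('a \<Rightarrow> real) \<Rightarrow> 'i \<Rightarrow> 'a \<Rightarrow> 'e" where
  "gradient N r i x =
     sharp (metric N i (chart N i x)) (frechet_derivative (r \<circ> cinv N i) (at (chart N i x)))"

definition hessian ::
  "('i, 'a, 'e::euclidean_space) riem \<Rightarrow> ('a \<Rightarrow> real) \<Rightarrow> 'i \<Rightarrow> 'a \<Rightarrow> 'e \<Rightarrow> 'e \<Rightarrow> real" where
  "hessian N r i x v w =
     dir_deriv2 (r \<circ> cinv N i) (chart N i x) v w
     - frechet_derivative (r \<circ> cinv N i) (at (chart N i x)) (christoffel N i (chart N i x) v w)"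

definition laplacian :: "('i, 'a, 'e::euclidean_space) riem \<Rightarrow> ('a \<Rightarrow> real) \<Rightarrow> 'i \<Rightarrow> 'a \<Rightarrow> real" where
  "laplacian N r i x = metric_trace (metric N i (chart N i x)) (hessian N r i x)"

text \<open>The function \<open>r\<close> is isoparametric, as witnessed by \<open>\<alpha>\<close> and \<open>\<beta>\<close>.\<close>

definition isoparametric ::
  "('i, 'a, 'e::euclidean_space) riem \<Rightarrow> ('a \<Rightarrow> real) \<Rightarrow> (real \<Rightarrow> real) \<Rightarrow> (real \<Rightarrow> real) \<Rightarrow> bool" where
  "isoparametric N r \<alpha> \<beta> \<longleftrightarrow>
     smooth_fun N r \<and> \<not> r constant_on UNIV \<and>
     smooth_on_set (range r) \<alpha> \<and> smooth_on_set (range r) \<beta> \<and>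
     (\<forall>i. \<forall>x \<in> chart_dom N i.
        metric N i (chart N i x) (gradient N r i x) (gradient N r i x) = \<alpha> (r x) \<and>
        laplacian N r i x = \<beta> (r x))"

definition prod_line :: "('i, 'a, 'e) riem \<Rightarrow> ('i, 'a \<times> real, 'e \<times> real) riem" where
  "prod_line N =
     \<lparr>chart_dom = (\<lambda>i. chart_dom N i \<times> UNIV),
      chart = (\<lambda>i (x, s). (chart N i x, s)),
      metric = (\<lambda>i (y, s) (v, a) (w, b). metric N i y v w + a * b)\<rparr>"


section \<open>Immersions and mean curvature flow\<close>

text \<open>In this section \<open>M\<close> is an open subset of \<open>N\<close>, the target is \<open>P\<close>, and \<open>i\<close>, \<open>j\<close> are
  charts of \<open>N\<close> around \<open>x\<close> and of \<open>P\<close> around the image of \<open>x\<close>. Tangent vectors of \<open>P\<close> are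
  given by their components in chart \<open>j\<close>.\<close>

definition local_rep ::
  "('i, 'a, 'e) riem \<Rightarrow> ('j, 'b, 'f) riem \<Rightarrow> ('a \<Rightarrow> 'b) \<Rightarrow> 'i \<Rightarrow> 'j \<Rightarrow> 'e \<Rightarrow> 'f" where
  "local_rep N P f i j = chart P j \<circ> f \<circ> cinv N i"

definition differential ::
  "('i, 'a, 'e::euclidean_space) riem \<Rightarrow> ('j, 'b, 'f::euclidean_space) riem \<Rightarrow>
   ('a \<Rightarrow> 'b) \<Rightarrow> 'i \<Rightarrow> 'j \<Rightarrow> 'a \<Rightarrow> 'e \<Rightarrow> 'f" where
  "differential N P f i j x = frechet_derivative (local_rep N P f i j) (at (chart N i x))"

definition immersion ::
  "('i, 'a::topological_space, 'e::euclidean_space) riem \<Rightarrow> 'a set \<Rightarrow>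
   ('j, 'b::topological_space, 'f::euclidean_space) riem \<Rightarrow> ('a \<Rightarrow> 'b) \<Rightarrow> bool" where
  "immersion N M P f \<longleftrightarrow>
     continuous_on M f \<and>
     (\<forall>i j. smooth_on (chart N i ` {x \<in> M \<inter> chart_dom N i. f x \<in> chart_dom P j})
              (local_rep N P f i j)) \<and>
     (\<forall>i j. \<forall>x \<in> M \<inter> chart_dom N i. f x \<in> chart_dom P j \<longrightarrow> inj (differential N P f i j x))"

definition smooth_family_of_immersions ::
  "('i, 'a::topological_space, 'e::euclidean_space) riem \<Rightarrow> 'a set \<Rightarrow>
   ('j, 'b::topological_space, 'f::euclidean_space) riem \<Rightarrow> real set \<Rightarrow> (real \<Rightarrow> 'a \<Rightarrow> 'b) \<Rightarrow> bool" where
  "smooth_family_of_immersions N M P I f \<longleftrightarrow>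
     (\<forall>t\<in>I. immersion N M P (f t)) \<and>
     continuous_on (I \<times> M) (\<lambda>(t, x). f t x) \<and>
     (\<forall>i j. smooth_on
        {(t, chart N i x) | t x. t \<in> I \<and> x \<in> M \<inter> chart_dom N i \<and> f t x \<in> chart_dom P j}
        (\<lambda>(t, y). local_rep N P (f t) i j y))"

definition induced_metric ::
  "('i, 'a, 'e::euclidean_space) riem \<Rightarrow> ('j, 'b, 'f::euclidean_space) riem \<Rightarrow>
   ('a \<Rightarrow> 'b) \<Rightarrow> 'i \<Rightarrow> 'j \<Rightarrow> 'a \<Rightarrow> 'e \<Rightarrow> 'e \<Rightarrow> real" where
  "induced_metric N P f i j x v w =
     metric P j (chart P j (f x)) (differential N P f i j x v) (differential N P f i j x w)"

definition normal_component ::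
  "('i, 'a, 'e::euclidean_space) riem \<Rightarrow> ('j, 'b, 'f::euclidean_space) riem \<Rightarrow>
   ('a \<Rightarrow> 'b) \<Rightarrow> 'i \<Rightarrow> 'j \<Rightarrow> 'a \<Rightarrow> 'f \<Rightarrow> 'f" where
  "normal_component N P f i j x =
     normal_part (metric P j (chart P j (f x))) (differential N P f i j x)"

text \<open>The normal component of the ambient covariant derivative of \<open>df(w)\<close> in direction \<open>df(v)\<close>,
  for vector fields \<open>v\<close>, \<open>w\<close> with constant components in chart \<open>i\<close>.\<close>

definition second_fundamental_form ::
  "('i, 'a, 'e::euclidean_space) riem \<Rightarrow> ('j, 'b, 'f::euclidean_space) riem \<Rightarrow>
   ('a \<Rightarrow> 'b) \<Rightarrow> 'i \<Rightarrow> 'j \<Rightarrow> 'a \<Rightarrow> 'e \<Rightarrow> 'e \<Rightarrow> 'f" where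
  "second_fundamental_form N P f i j x v w =
     normal_component N P f i j x
       (dir_deriv2 (local_rep N P f i j) (chart N i x) v w
        + christoffel P j (chart P j (f x)) (differential N P f i j x v) (differential N P f i j x w))"

text \<open>The trace of the second fundamental form, not divided by the dimension.\<close>

definition mean_curvature_vector ::
  "('i, 'a, 'e::euclidean_space) riem \<Rightarrow> ('j, 'b, 'f::euclidean_space) riem \<Rightarrow>
   ('a \<Rightarrow> 'b) \<Rightarrow> 'i \<Rightarrow> 'j \<Rightarrow> 'a \<Rightarrow> 'f" where
  "mean_curvature_vector N P f i j x =
     metric_trace (induced_metric N P f i j x) (second_fundamental_form N P f i j x)"

definition normal_velocity ::
  "('i, 'a, 'e::euclidean_space) riem \<Rightarrow> ('j, 'b, 'f::euclidean_space) riem \<Rightarrow>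
   (real \<Rightarrow> 'a \<Rightarrow> 'b) \<Rightarrow> real \<Rightarrow> 'i \<Rightarrow> 'j \<Rightarrow> 'a \<Rightarrow> 'f" where
  "normal_velocity N P f t i j x =
     normal_component N P (f t) i j x (vector_derivative (\<lambda>s. chart P j (f s x)) (at t))"

definition mean_curvature_flow ::
  "('i, 'a::topological_space, 'e::euclidean_space) riem \<Rightarrow> 'a set \<Rightarrow>
   ('j, 'b::topological_space, 'f::euclidean_space) riem \<Rightarrow> real set \<Rightarrow> (real \<Rightarrow> 'a \<Rightarrow> 'b) \<Rightarrow> bool" where
  "mean_curvature_flow N M P I f \<longleftrightarrow>
     open I \<and> is_interval I \<and> 0 \<in> I \<and>
     smooth_family_of_immersions N M P I f \<and>
     (\<forall>t\<in>I. \<forall>i j. \<forall>x \<in> M \<inter> chart_dom N i. f t x \<in> chart_dom P j \<longrightarrow>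
        normal_velocity N P f t i j x = mean_curvature_vector N P (f t) i j x)"

definition vertical_translation :: "real \<Rightarrow> 'a \<times> real \<Rightarrow> 'a \<times> real" where
  "vertical_translation t = (\<lambda>(x, s). (x, s + t))"

text \<open>The mean curvature flow \<open>f\<close> in \<open>N \<times> \<real>\<close>, defined for \<open>t \<in> I\<close>, starts from the graph of
  \<open>u\<close> over \<open>M\<close> and is a translating soliton.\<close>

definition translating_soliton ::
  "('i, 'a::topological_space, 'e::euclidean_space) riem \<Rightarrow> 'a set \<Rightarrow> ('a \<Rightarrow> real) \<Rightarrow>
   real set \<Rightarrow> (real \<Rightarrow> 'a \<Rightarrow> 'a \<times> real) \<Rightarrow> bool" where
  "translating_soliton N M u I f \<longleftrightarrow>
     mean_curvature_flow N M (prod_line N) I f \<and>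
     (\<forall>x\<in>M. f 0 x = (x, u x)) \<and>
     (let g = (\<lambda>t. inv (vertical_translation t) \<circ> f t) in
        \<forall>t\<in>I. \<forall>i j. \<forall>x \<in> M \<inter> chart_dom N i. g t x \<in> chart_dom (prod_line N) j \<longrightarrow>
          normal_velocity N (prod_line N) g t i j x = 0)"

definition soliton_equation :: "real set \<Rightarrow> (real \<Rightarrow> real) \<Rightarrow> (real \<Rightarrow> real) \<Rightarrow> (real \<Rightarrow> real) \<Rightarrow> bool" where
  "soliton_equation J \<alpha> \<beta> V \<longleftrightarrow>
     (\<forall>s\<in>J.
        2 * \<alpha> s * deriv_on J (deriv_on J V) s
        - \<alpha> s * (deriv_on J \<alpha> s - 2 * \<beta> s) * deriv_on J V s ^ 3
        - 2 * \<alpha> s * deriv_on J V s ^ 2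
        + 2 * \<beta> s * deriv_on J V s
        - 2 = 0)"

end

theory Submission
  imports Defs
begin

text \<open>The graph of \<open>u = V \<circ> r\<close> has mean curvature vector \<open>T \<cdot> \<nu>\<close>, where \<open>\<nu>\<close> is the normal component of
  the vertical unit field and \<open>T\<close> is the trace of the Hessian of \<open>u\<close> with respect to the induced metric
  \<open>g + du \<otimes> du\<close>. Since \<open>\<nu>\<close> vanishes nowhere, the graph is a translating soliton iff \<open>T = 1\<close>. The induced
  metric is a rank one perturbation of \<open>g\<close>, so \<open>T\<close> is an explicit expression in \<open>V'\<close>, \<open>V''\<close>,
  \<open>\<alpha> = \<parallel>\<nabla>r\<parallel>\<^sup>2\<close>, \<open>\<beta> = \<Delta>r\<close> and \<open>Hess r(\<nabla>r, \<nabla>r) = \<alpha> \<alpha>' / 2\<close>; clearing the denominator \<open>1 + \<alpha> V'\<^sup>2\<close> turns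
  \<open>T = 1\<close> into the differential equation.\<close>

section \<open>Smooth functions\<close>

text \<open>Undoing the translation changes the velocity of the family by the vertical unit field,
  so the soliton condition says that the normal velocity is \<nu>, while the flow equation says that
  it is T times \<nu>. Necessity uses only time 0.

  Two obstacles shape the rest. First, the charts of the domain and of the target are chosen
  independently, so in coordinates the horizontal part of a graph is a transition map and not the
  identity. Its second derivative is absorbed by the transformation law of the Christoffel symbols,
  which in turn rests on the symmetry of second derivatives. Second, \<open>V\<close> and \<alpha>
  are smooth on sets that need not be open, so all calculus is done with smooth extensions. Their
  derivatives are the ones in the equation because the image of the connected set \<open>M\<close>
  under \<open>r\<close> has no isolated point, unless it is a single point. In that case \<alpha>
  and \<beta> vanish there, and both the equation and T = 1 are impossible.\<close>

lemma Ck_on_subset: "Ck_on k T f \<Longrightarrow> S \<subseteq> T \<Longrightarrow> Ck_on k S f"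
  by (induction k arbitrary: f) (auto intro: continuous_on_subset)

lemma Ck_on_has_derivative:
  assumes "Ck_on (Suc k) S f" "x \<in> S"
  shows "(f has_derivative frechet_derivative f (at x)) (at x)"
proof -
  have "f differentiable at x" using assms by simp
  then show ?thesis by (rule iffD1[OF frechet_derivative_works])
qed

text \<open>Derivatives are taken at \<open>at x\<close>, unrestricted, so agreement on
  \<open>S\<close> passes to them because \<open>S\<close> is a neighbourhood of each of its
  points.\<close>

lemma Ck_on_cong:
  assumes "open S" "Ck_on k S f" "\<And>x. x \<in> S \<Longrightarrow> f x = g x"
  shows "Ck_on k S g"
  using assms(2,3)
proof (induction k arbitrary: f g)
  case 0
  then show ?case by (simp cong: continuous_on_cong)
next
  case (Suc k)
  have d: "(g has_derivative frechet_derivative f (at x)) (at x)" if "x \<in> S" for x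
    using Ck_on_has_derivative[OF Suc.prems(1) that] \<open>open S\<close> that Suc.prems(2)
    by (rule has_derivative_transform_within_open)
  have "Ck_on k S (\<lambda>x. frechet_derivative g (at x) v)" for v
  proof (rule Suc.IH)
    show "Ck_on k S (\<lambda>x. frechet_derivative f (at x) v)"
      using Suc.prems(1) by simp
    show "frechet_derivative f (at x) v = frechet_derivative g (at x) v" if "x \<in> S" for x
      using frechet_derivative_at[OF d[OF that]] by (rule fun_cong)
  qed
  moreover have "g differentiable at x" if "x \<in> S" for x
    using d[OF that] by (rule differentiableI)
  ultimately show ?case by simp
qed

text \<open>Lets an explicit derivative stand in for the choice operator
  \<open>frechet_derivative\<close>; the closure properties below are proved through it.\<close>

lemma Ck_on_SucI:
  assumes "open S" "\<And>x. x \<in> S \<Longrightarrow> (f has_derivative f' x) (at x)"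
    and "\<And>v. Ck_on k S (\<lambda>x. f' x v)"
  shows "Ck_on (Suc k) S f"
proof -
  have eq: "f' x = frechet_derivative f (at x)" if "x \<in> S" for x
    using assms(2)[OF that] by (rule frechet_derivative_at)
  have 1: "Ck_on k S (\<lambda>x. frechet_derivative f (at x) v)" for v
    using assms(1) assms(3)[of v] by (rule Ck_on_cong) (simp only: eq)
  have 2: "f differentiable at x" if "x \<in> S" for x
    using assms(2)[OF that] by (rule differentiableI)
  show ?thesis using 1 2 by simp
qed

lemma Ck_on_SucD: "Ck_on (Suc k) S f \<Longrightarrow> Ck_on k S f"
proof (induction k arbitrary: f)
  case 0
  then show ?case
    by (simp add: continuous_at_imp_continuous_on differentiable_imp_continuous_within)
next
  case (Suc k)
  have "Ck_on k S (\<lambda>x. frechet_derivative f (at x) v)" for v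
    using Suc.prems by (intro Suc.IH) simp
  then show ?case using Suc.prems by simp
qed

lemma Ck_on_const: "open S \<Longrightarrow> Ck_on k S (\<lambda>x. c)"
proof (induction k arbitrary: c)
  case (Suc k)
  then show ?case by (intro Ck_on_SucI[where f' = "\<lambda>_ _. 0"]) auto
qed simp

lemma Ck_on_bounded_linear:
  assumes "open S" "bounded_linear f"
  shows "Ck_on k S f"
proof (cases k)
  case 0
  then show ?thesis using assms by (simp add: linear_continuous_on)
next
  case (Suc m)
  show ?thesis unfolding Suc
    using assms by (intro Ck_on_SucI[where f' = "\<lambda>_. f"])
      (auto intro: bounded_linear_imp_has_derivative Ck_on_const)
qed

lemma Ck_on_add:
  assumes "open S" "Ck_on k S f" "Ck_on k S g"
  shows "Ck_on k S (\<lambda>x. f x + g x)"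
  using assms(2,3)
proof (induction k arbitrary: f g)
  case 0
  then show ?case by (simp add: continuous_on_add)
next
  case (Suc k)
  show ?case
    using Suc.prems Suc.IH \<open>open S\<close>
    by (intro Ck_on_SucI[where f' = "\<lambda>x v. frechet_derivative f (at x) v + frechet_derivative g (at x) v"]
        has_derivative_add iffD1[OF frechet_derivative_works]) auto
qed

lemma Ck_on_mult:
  fixes f g :: "'a::real_normed_vector \<Rightarrow> real"
  assumes "open S" "Ck_on k S f" "Ck_on k S g"
  shows "Ck_on k S (\<lambda>x. f x * g x)"
  using assms(2,3)
proof (induction k arbitrary: f g)
  case 0
  then show ?case by (simp add: continuous_on_mult)
next
  case (Suc k)
  show ?case
  proof (intro Ck_on_SucI[where f' = "\<lambda>x v. f x * frechet_derivative g (at x) v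
        + frechet_derivative f (at x) v * g x"] has_derivative_mult iffD1[OF frechet_derivative_works])
    show "Ck_on k S (\<lambda>x. f x * frechet_derivative g (at x) v
        + frechet_derivative f (at x) v * g x)" for v
      using Suc.prems Ck_on_SucD[OF Suc.prems(1)] Ck_on_SucD[OF Suc.prems(2)] \<open>open S\<close>
      by (intro Ck_on_add Suc.IH) auto
  qed (use Suc.prems \<open>open S\<close> in auto)
qed

lemma Ck_on_Pair:
  assumes "open S" "Ck_on k S f" "Ck_on k S g"
  shows "Ck_on k S (\<lambda>x. (f x, g x))"
  using assms(2,3)
proof (induction k arbitrary: f g)
  case 0
  then show ?case by (simp add: continuous_on_Pair)
next
  case (Suc k)
  show ?case
    using Suc.prems Suc.IH \<open>open S\<close>
    by (intro Ck_on_SucI[where f' = "\<lambda>x v. (frechet_derivative f (at x) v, frechet_derivative g (at x) v)"]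
        has_derivative_Pair iffD1[OF frechet_derivative_works]) auto
qed

text \<open>A linear inner map has constant derivative, so each differentiation only replaces the
  direction \<open>v\<close> by \<open>L v\<close>, and the induction closes without a product
  rule.\<close>

lemma Ck_on_compose_linear:
  assumes "open S" "open T" "bounded_linear L" "L ` S \<subseteq> T" "Ck_on k T f"
  shows "Ck_on k S (\<lambda>x. f (L x))"
  using assms(5)
proof (induction k arbitrary: f)
  case 0
  then show ?case
    using continuous_on_compose2[of T f S L] assms by (simp add: linear_continuous_on)
next
  case (Suc k)
  have "((\<lambda>x. f (L x)) has_derivative (\<lambda>v. frechet_derivative f (at (L x)) (L v))) (at x)"
    if "x \<in> S" for x
    using has_derivative_compose[OF bounded_linear_imp_has_derivative[OF assms(3), of "at x"]
        Ck_on_has_derivative[OF Suc.prems]] that assms(4) by auto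
  moreover have "Ck_on k S (\<lambda>x. frechet_derivative f (at (L x)) (L v))" for v
    using Suc.prems by (intro Suc.IH) auto
  ultimately show ?case
    by (rule Ck_on_SucI[OF \<open>open S\<close>])
qed

lemma linear_real_apply: "linear f \<Longrightarrow> f (a::real) = a *\<^sub>R f 1"
  using linear_cmul[of f a 1] by simp

text \<open>With an outer function on the line the chain rule yields a product of two real
  functions, so closure under products completes the induction.\<close>

lemma Ck_on_compose_real:
  fixes W :: "real \<Rightarrow> real"
  assumes "open S" "open U" "Ck_on k U W" "Ck_on k S f" "f ` S \<subseteq> U"
  shows "Ck_on k S (\<lambda>x. W (f x))"
  using assms(3,4)
proof (induction k arbitrary: W)
  case 0
  then show ?case
    using continuous_on_compose2[of U W S f] assms(5) by simp
next
  case (Suc k)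
  have "((\<lambda>x. W (f x)) has_derivative
      (\<lambda>v. frechet_derivative W (at (f x)) 1 * frechet_derivative f (at x) v)) (at x)"
    if "x \<in> S" for x
  proof -
    have "f x \<in> U" using that assms(5) by blast
    then have W: "(W has_derivative frechet_derivative W (at (f x))) (at (f x))"
      by (rule Ck_on_has_derivative[OF Suc.prems(1)])
    have "((\<lambda>x. W (f x)) has_derivative (\<lambda>v. frechet_derivative W (at (f x)) (frechet_derivative f (at x) v))) (at x)"
      using Ck_on_has_derivative[OF Suc.prems(2) that] W by (rule has_derivative_compose)
    then show ?thesis
    proof (rule has_derivative_eq_rhs, intro ext)
      fix v
      show "frechet_derivative W (at (f x)) (frechet_derivative f (at x) v)
         = frechet_derivative W (at (f x)) 1 * frechet_derivative f (at x) v"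
        by (subst linear_real_apply[OF has_derivative_linear[OF W]]) simp
    qed
  qed
  moreover have "Ck_on k S (\<lambda>x. frechet_derivative W (at (f x)) 1 * frechet_derivative f (at x) v)" for v
  proof (rule Ck_on_mult[OF \<open>open S\<close>])
    show "Ck_on k S (\<lambda>x. frechet_derivative W (at (f x)) 1)"
    proof (rule Suc.IH)
      show "Ck_on k U (\<lambda>s. frechet_derivative W (at s) 1)" using Suc.prems(1) by simp
      show "Ck_on k S f" by (rule Ck_on_SucD[OF Suc.prems(2)])
    qed
    show "Ck_on k S (\<lambda>x. frechet_derivative f (at x) v)"
      using Suc.prems(2) by simp
  qed
  ultimately show ?case
    by (rule Ck_on_SucI[OF \<open>open S\<close>])
qed

lemma smooth_on_subset: "smooth_on T f \<Longrightarrow> S \<subseteq> T \<Longrightarrow> smooth_on S f"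
  by (auto simp: smooth_on_def intro: Ck_on_subset)

lemma smooth_on_has_derivative:
  "smooth_on S f \<Longrightarrow> x \<in> S \<Longrightarrow> (f has_derivative frechet_derivative f (at x)) (at x)"
  unfolding smooth_on_def by (rule Ck_on_has_derivative[of 0]) (erule spec)

lemma smooth_on_differentiable: "smooth_on S f \<Longrightarrow> x \<in> S \<Longrightarrow> f differentiable at x"
  by (rule differentiableI[OF smooth_on_has_derivative])

lemma smooth_on_frechet_derivative:
  "smooth_on S f \<Longrightarrow> smooth_on S (\<lambda>x. frechet_derivative f (at x) v)"
  unfolding smooth_on_def
proof
  fix k assume "\<forall>k. Ck_on k S f"
  then have "Ck_on (Suc k) S f" ..
  then show "Ck_on k S (\<lambda>x. frechet_derivative f (at x) v)" by simp
qed

lemma smooth_on_continuous_on: "smooth_on S f \<Longrightarrow> continuous_on S f"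
  unfolding smooth_on_def by (drule spec[of _ 0]) simp

section \<open>Symmetry of second derivatives\<close>

text \<open>The mean value theorem is applied twice: along \<open>v\<close> to the increment in
  direction \<open>w\<close>, then along \<open>w\<close> to the \<open>v\<close>-derivative. The
  inner derivative is therefore the one along \<open>v\<close>, whence the order \<open>w v\<close>
  in \<open>dir_deriv2\<close>.\<close>

lemma mixed_difference_mean_value:
  fixes f :: "'a::real_normed_vector \<Rightarrow> real"
  assumes f: "\<And>y. y \<in> T \<Longrightarrow> f differentiable at y"
    and f1: "\<And>y. y \<in> T \<Longrightarrow> (\<lambda>z. frechet_derivative f (at z) v) differentiable at y"
    and "0 < s" and T: "\<And>a b. \<lbrakk>0 \<le> a; a \<le> s; 0 \<le> b; b \<le> s\<rbrakk> \<Longrightarrow> x + a *\<^sub>R v + b *\<^sub>R w \<in> T"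
  obtains a b where "0 < a" "a < s" "0 < b" "b < s"
    "f (x + s *\<^sub>R v + s *\<^sub>R w) - f (x + s *\<^sub>R v) - f (x + s *\<^sub>R w) + f x
      = s^2 * dir_deriv2 f (x + a *\<^sub>R v + b *\<^sub>R w) w v"
proof -
  \<comment> \<open>The summand \<open>0 *\<^sub>R w\<close> is kept so that \<open>D\<close> covers
    both terms, with \<open>b = s\<close> and \<open>b = 0\<close>.\<close>
  define \<phi> where "\<phi> = (\<lambda>a. f (x + a *\<^sub>R v + s *\<^sub>R w) - f (x + a *\<^sub>R v + 0 *\<^sub>R w))"
  define \<phi>' where "\<phi>' = (\<lambda>a. frechet_derivative f (at (x + a *\<^sub>R v + s *\<^sub>R w)) v
     - frechet_derivative f (at (x + a *\<^sub>R v + 0 *\<^sub>R w)) v)"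
  have D: "((\<lambda>a. f (x + a *\<^sub>R v + b *\<^sub>R w)) has_real_derivative
      frechet_derivative f (at (x + a *\<^sub>R v + b *\<^sub>R w)) v) (at a)"
    if "0 \<le> a" "a \<le> s" "0 \<le> b" "b \<le> s" for a b
  proof -
    have d: "(f has_derivative frechet_derivative f (at (x + a *\<^sub>R v + b *\<^sub>R w))) (at (x + a *\<^sub>R v + b *\<^sub>R w))"
      using f T that by (simp add: frechet_derivative_works)
    have "((\<lambda>a. x + a *\<^sub>R v + b *\<^sub>R w) has_derivative (\<lambda>h. h *\<^sub>R v)) (at a)"
      by (auto intro!: derivative_eq_intros)
    from has_derivative_compose[OF this d] show ?thesis
      using linear_cmul[OF has_derivative_linear[OF d]]
      by (simp add: has_field_derivative_def mult.commute[of _ "frechet_derivative f (at (x + a *\<^sub>R v + b *\<^sub>R w)) v"])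
  qed
  have "\<exists>a>0. a < s \<and> \<phi> s - \<phi> 0 = (s - 0) * \<phi>' a"
    unfolding \<phi>_def \<phi>'_def using \<open>0 < s\<close> by (intro MVT2 DERIV_diff D) auto
  then obtain a where a: "0 < a" "a < s" "\<phi> s - \<phi> 0 = s * \<phi>' a" by auto
  define \<psi> where "\<psi> = (\<lambda>b. frechet_derivative f (at (x + a *\<^sub>R v + b *\<^sub>R w)) v)"
  have E: "(\<psi> has_real_derivative dir_deriv2 f (x + a *\<^sub>R v + b *\<^sub>R w) w v) (at b)"
    if "0 \<le> b" "b \<le> s" for b
  proof -
    have d: "((\<lambda>z. frechet_derivative f (at z) v) has_derivative
       (\<lambda>h. dir_deriv2 f (x + a *\<^sub>R v + b *\<^sub>R w) h v)) (at (x + a *\<^sub>R v + b *\<^sub>R w))"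
      using f1 T that a unfolding dir_deriv2_def by (simp add: frechet_derivative_works[symmetric])
    have "((\<lambda>b. x + a *\<^sub>R v + b *\<^sub>R w) has_derivative (\<lambda>h. h *\<^sub>R w)) (at b)"
      by (auto intro!: derivative_eq_intros)
    from has_derivative_compose[OF this d] show ?thesis
      using linear_cmul[OF has_derivative_linear[OF d]]
      by (simp add: has_field_derivative_def \<psi>_def mult.commute[of _ "dir_deriv2 f (x + a *\<^sub>R v + b *\<^sub>R w) w v"])
  qed
  have "\<exists>b>0. b < s \<and> \<psi> s - \<psi> 0 = (s - 0) * dir_deriv2 f (x + a *\<^sub>R v + b *\<^sub>R w) w v"
    using E \<open>0 < s\<close> by (intro MVT2) auto
  then obtain b where b: "0 < b" "b < s"
    "\<psi> s - \<psi> 0 = s * dir_deriv2 f (x + a *\<^sub>R v + b *\<^sub>R w) w v" by auto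
  have "\<phi>' a = \<psi> s - \<psi> 0" by (simp add: \<phi>'_def \<psi>_def)
  then have "\<phi> s - \<phi> 0 = s^2 * dir_deriv2 f (x + a *\<^sub>R v + b *\<^sub>R w) w v"
    using a b by (simp add: power2_eq_square)
  then show ?thesis
    using that[OF a(1,2) b(1,2)] by (simp add: \<phi>_def)
qed

text \<open>The second difference is symmetric in \<open>v\<close> and \<open>w\<close>; divided by
  \<open>s^2\<close> it is a value, near \<open>x\<close>, of either mixed derivative, and both are
  continuous.\<close>

lemma dir_deriv2_symmetric_real:
  fixes f :: "'a::real_normed_vector \<Rightarrow> real"
  assumes "open S" "Ck_on 2 S f" "x \<in> S"
  shows "dir_deriv2 f x v w = dir_deriv2 f x w v"
proof -
  have C: "Ck_on (Suc (Suc 0)) S f" using assms(2) by (simp add: numeral_2_eq_2)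
  have f: "f differentiable at y" "(\<lambda>z. frechet_derivative f (at z) u) differentiable at y" if "y \<in> S" for y u
    using C that by auto
  have cont: "continuous_on S (\<lambda>y. dir_deriv2 f y u u')" for u u'
    using C unfolding dir_deriv2_def by simp
  have "\<bar>dir_deriv2 f x v w - dir_deriv2 f x w v\<bar> \<le> 2 * e" if "0 < e" for e
  proof -
    have ev: "\<forall>\<^sub>F y in nhds x. y \<in> S \<and> dist (dir_deriv2 f y v w) (dir_deriv2 f x v w) < e
       \<and> dist (dir_deriv2 f y w v) (dir_deriv2 f x w v) < e"
    proof (intro eventually_conj)
      show "\<forall>\<^sub>F y in nhds x. y \<in> S" using assms by (simp add: eventually_nhds_in_open)
      have "((\<lambda>y. dir_deriv2 f y u u') \<longlongrightarrow> dir_deriv2 f x u u') (nhds x)" for u u'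
      proof -
        have "isCont (\<lambda>y. dir_deriv2 f y u u') x"
          using cont[of u u'] assms(1,3) by (metis continuous_on_eq_continuous_at)
        then show ?thesis
          using tendsto_at_iff_tendsto_nhds[of "\<lambda>y. dir_deriv2 f y u u'" x] by (simp only: isCont_def)
      qed
      then show "\<forall>\<^sub>F y in nhds x. dist (dir_deriv2 f y v w) (dir_deriv2 f x v w) < e"
        "\<forall>\<^sub>F y in nhds x. dist (dir_deriv2 f y w v) (dir_deriv2 f x w v) < e"
        using that by (auto intro: tendstoD)
    qed
    then obtain d where "d > 0" and d: "\<And>y. dist y x < d \<Longrightarrow> y \<in> S
       \<and> dist (dir_deriv2 f y v w) (dir_deriv2 f x v w) < e
       \<and> dist (dir_deriv2 f y w v) (dir_deriv2 f x w v) < e"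
      unfolding eventually_nhds_metric by metis
    \<comment> \<open>Small enough for the parallelogram spanned by \<open>s *\<^sub>R v\<close> and
      \<open>s *\<^sub>R w\<close> to stay within distance \<open>d\<close> of \<open>x\<close>; the
      1 keeps the denominator positive when both vectors vanish.\<close>
    define s where "s = d / (2 * (norm v + norm w + 1))"
    have pos: "norm v + norm w + 1 > 0" by (simp add: add_nonneg_pos)
    have "s > 0" using \<open>d > 0\<close> pos by (simp add: s_def)
    have near: "dist (x + a *\<^sub>R u + b *\<^sub>R u') x < d"
      if "0 \<le> a" "a \<le> s" "0 \<le> b" "b \<le> s" "norm u + norm u' = norm v + norm w" for a b u u'
    proof -
      have "dist (x + a *\<^sub>R u + b *\<^sub>R u') x \<le> a * norm u + b * norm u'"
        using that norm_triangle_ineq[of "a *\<^sub>R u" "b *\<^sub>R u'"] by (simp add: dist_norm add.assoc)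
      also have "\<dots> \<le> s * norm u + s * norm u'"
        using that by (intro add_mono mult_right_mono) auto
      also have "\<dots> = s * (norm v + norm w)" using that(5) by (metis distrib_left)
      also have "\<dots> < d"
      proof -
        have "s * (norm v + norm w) < s * (2 * (norm v + norm w + 1))"
          using \<open>s > 0\<close> pos by (intro mult_strict_left_mono) auto
        also have "\<dots> = d" using pos by (simp add: s_def)
        finally show ?thesis .
      qed
      finally show ?thesis .
    qed
    define \<Delta> where "\<Delta> = f (x + s *\<^sub>R v + s *\<^sub>R w) - f (x + s *\<^sub>R v) - f (x + s *\<^sub>R w) + f x"
    obtain a b where ab: "0 < a" "a < s" "0 < b" "b < s"
      "\<Delta> = s^2 * dir_deriv2 f (x + a *\<^sub>R v + b *\<^sub>R w) w v"
    proof (rule mixed_difference_mean_value[of S f v s x w])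
      show "x + a *\<^sub>R v + b *\<^sub>R w \<in> S" if "0 \<le> a" "a \<le> s" "0 \<le> b" "b \<le> s" for a b
        using d[OF near[OF that]] by simp
    qed (use f \<open>s > 0\<close> in \<open>auto simp: \<Delta>_def\<close>)
    have "\<Delta> = f (x + s *\<^sub>R w + s *\<^sub>R v) - f (x + s *\<^sub>R w) - f (x + s *\<^sub>R v) + f x"
      by (simp add: \<Delta>_def algebra_simps)
    moreover obtain a' b' where ab': "0 < a'" "a' < s" "0 < b'" "b' < s"
      "f (x + s *\<^sub>R w + s *\<^sub>R v) - f (x + s *\<^sub>R w) - f (x + s *\<^sub>R v) + f x
         = s^2 * dir_deriv2 f (x + a' *\<^sub>R w + b' *\<^sub>R v) v w"
    proof (rule mixed_difference_mean_value[of S f w s x v])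
      show "x + a *\<^sub>R w + b *\<^sub>R v \<in> S" if "0 \<le> a" "a \<le> s" "0 \<le> b" "b \<le> s" for a b
        using d[OF near[OF that]] by simp
    qed (use f \<open>s > 0\<close> in auto)
    ultimately have "dir_deriv2 f (x + a *\<^sub>R v + b *\<^sub>R w) w v = dir_deriv2 f (x + a' *\<^sub>R w + b' *\<^sub>R v) v w"
      using ab(5) \<open>s > 0\<close> by simp
    moreover have "dist (dir_deriv2 f (x + a *\<^sub>R v + b *\<^sub>R w) w v) (dir_deriv2 f x w v) < e"
      using d near ab by simp
    moreover have "dist (dir_deriv2 f (x + a' *\<^sub>R w + b' *\<^sub>R v) v w) (dir_deriv2 f x v w) < e"
      using d near[of a' b' w v] ab' by (simp add: add.commute)
    ultimately show ?thesis by (simp add: dist_real_def)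
  qed
  \<comment> \<open>If the two values differed, a quarter of the gap as \<open>e\<close> would bound
    the gap by half of itself.\<close>
  from this[of "\<bar>dir_deriv2 f x v w - dir_deriv2 f x w v\<bar> / 4"] show ?thesis
    by (cases "dir_deriv2 f x v w = dir_deriv2 f x w v") auto
qed

lemma Ck_on_bounded_linear_compose:
  assumes "open S" "bounded_linear L" "Ck_on k S f"
  shows "Ck_on k S (\<lambda>x. L (f x))"
  using assms(3)
proof (induction k arbitrary: f)
  case 0
  then show ?case using assms(2) bounded_linear.continuous_on by auto
next
  case (Suc k)
  then show ?case
    using assms by (intro Ck_on_SucI[where f' = "\<lambda>x v. L (frechet_derivative f (at x) v)"]
        bounded_linear.has_derivative[OF assms(2)] iffD1[OF frechet_derivative_works]) auto
qed

text \<open>The mean value theorem is a statement about real functions, so the vector-valued case is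
  read off componentwise.\<close>

lemma dir_deriv2_symmetric:
  fixes f :: "'a::real_normed_vector \<Rightarrow> 'b::euclidean_space"
  assumes "open S" "smooth_on S f" "x \<in> S"
  shows "dir_deriv2 f x v w = dir_deriv2 f x w v"
proof (rule euclidean_eqI)
  fix b :: 'b
  have "dir_deriv2 (\<lambda>z. f z \<bullet> b) x v w = dir_deriv2 f x v w \<bullet> b" for v w
  proof -
    have 1: "frechet_derivative (\<lambda>z. f z \<bullet> b) (at z) w = frechet_derivative f (at z) w \<bullet> b"
      if "z \<in> S" for z
      using frechet_derivative_at[OF has_derivative_inner_left[OF smooth_on_has_derivative[OF assms(2) that], of b]]
      by (simp add: fun_eq_iff)
    have "((\<lambda>z. frechet_derivative f (at z) w \<bullet> b) has_derivative (\<lambda>v. dir_deriv2 f x v w \<bullet> b)) (at x)"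
      unfolding dir_deriv2_def using assms
      by (intro has_derivative_inner_left smooth_on_has_derivative smooth_on_frechet_derivative)
    then have "((\<lambda>z. frechet_derivative (\<lambda>z. f z \<bullet> b) (at z) w) has_derivative (\<lambda>v. dir_deriv2 f x v w \<bullet> b)) (at x)"
      using assms(1,3) 1[symmetric] by (rule has_derivative_transform_within_open)
    from frechet_derivative_at[OF this] show ?thesis
      unfolding dir_deriv2_def[of "\<lambda>z. f z \<bullet> b"] by (simp add: fun_eq_iff)
  qed
  moreover have "dir_deriv2 (\<lambda>z. f z \<bullet> b) x v w = dir_deriv2 (\<lambda>z. f z \<bullet> b) x w v"
    using dir_deriv2_symmetric_real[OF assms(1)
        Ck_on_bounded_linear_compose[OF assms(1) bounded_linear_inner_left[of b]] assms(3)]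
      assms(2) by (simp add: smooth_on_def)
  ultimately show "dir_deriv2 f x v w \<bullet> b = dir_deriv2 f x w v \<bullet> b" by simp
qed

section \<open>Inner products, normal projections and traces\<close>

lemma inner_product_linear:
  assumes "inner_product G"
  shows "linear (G v)" "linear (\<lambda>v. G v w)"
  using assms by (auto simp: inner_product_def bilinear_def)

lemma inner_product_sym: "inner_product G \<Longrightarrow> G v w = G w v"
  by (simp add: inner_product_def)

lemma inner_product_zero_iff: "inner_product G \<Longrightarrow> G v v = 0 \<longleftrightarrow> v = 0"
  unfolding inner_product_def using bilinear_lzero[of G] by (metis less_irrefl)

lemma inner_product_nonneg: "inner_product G \<Longrightarrow> 0 \<le> G v v"
  unfolding inner_product_def using bilinear_lzero[of G] by (metis less_imp_le order_refl)

lemma inner_product_pullback: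
  assumes "inner_product G" "linear A" "inj A"
  shows "inner_product (\<lambda>v w. G (A v) (A w))"
proof -
  have "A v \<noteq> 0" if "v \<noteq> 0" for v
    using injD[OF assms(3), of v 0] linear_0[OF assms(2)] that by auto
  moreover have "linear (\<lambda>w. G (A v) (A w))" "linear (\<lambda>v. G (A v) (A w))" for v w
    using linear_compose[OF assms(2) inner_product_linear(1)[OF assms(1)]]
      linear_compose[OF assms(2) inner_product_linear(2)[OF assms(1)]] by (simp_all add: o_def)
  ultimately show ?thesis
    using assms(1) unfolding inner_product_def bilinear_def by simp
qed

text \<open>Positive definiteness turns the description in \<open>sharp\<close> into a definite
  vector. Later values of \<open>sharp\<close> are mostly found this way: exhibit a candidate and
  test it against all \<open>w\<close>.\<close>

lemma sharp_unique:
  assumes "inner_product G" "\<And>w. G v w = l w"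
  shows "sharp G l = v"
  unfolding sharp_def
proof (rule the_equality)
  fix v' assume *: "\<forall>w. G v' w = l w"
  have "G (v' - v) (v' - v) = 0"
    using linear_diff[OF inner_product_linear(2)[OF assms(1)]] assms(2) * by simp
  then show "v' = v"
    using assms(1) by (simp add: inner_product_zero_iff)
qed (use assms in simp)

lemma sharp_apply:
  fixes G :: "'e::euclidean_space \<Rightarrow> 'e \<Rightarrow> real"
  assumes "inner_product G" "linear l"
  shows "G (sharp G l) w = l w"
proof -
  \<comment> \<open>Lowering the index, in coordinates: \<open>L\<close> is injective because the
    inner product is definite, hence onto in finite dimension, and a preimage of the coordinates of
    \<open>l\<close> represents \<open>l\<close>.\<close>
  define L where "L v = (\<Sum>b\<in>Basis. G v b *\<^sub>R b)" for v
  have L: "L v \<bullet> b = G v b" if "b \<in> Basis" for v b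
    using that by (simp add: L_def inner_sum_left inner_Basis if_distrib cong: if_cong)
  have "linear L"
    using linear_add[OF inner_product_linear(2)[OF assms(1)]]
      linear_cmul[OF inner_product_linear(2)[OF assms(1)]]
    by (intro linearI) (simp_all add: L_def scaleR_add_left sum.distrib scaleR_sum_right)
  moreover have "v = 0" if "L v = 0" for v
  proof -
    have "G v = (\<lambda>w. 0)"
    proof (rule linear_eq_stdbasis[OF inner_product_linear(1)[OF assms(1)] linear_zero])
      show "G v b = 0" if "b \<in> Basis" for b
        using L[OF that, of v] \<open>L v = 0\<close> by simp
    qed
    then show ?thesis using inner_product_zero_iff[OF assms(1), of v] by simp
  qed
  ultimately have "surj L"
    by (intro linear_injective_imp_surjective) (simp_all add: linear_injective_0)
  then obtain v where v: "L v = (\<Sum>b\<in>Basis. l b *\<^sub>R b)" by (metis surjD)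
  have "G v = l"
  proof (rule linear_eq_stdbasis[OF inner_product_linear(1)[OF assms(1)] assms(2)])
    show "G v b = l b" if "b \<in> Basis" for b
      using L[OF that, of v] that unfolding v
      by (simp add: inner_sum_left inner_Basis if_distrib cong: if_cong)
  qed
  then show ?thesis
    using sharp_unique[OF assms(1), of v l] by simp
qed

lemma linear_sharp:
  fixes G :: "'e::euclidean_space \<Rightarrow> 'e \<Rightarrow> real"
  assumes "inner_product G" "\<And>w. linear (\<lambda>x. l x w)" "\<And>x. linear (l x)"
  shows "linear (\<lambda>x. sharp G (l x))"
proof (rule linearI)
  fix x y c
  note lin = linear_add[OF inner_product_linear(2)[OF assms(1)]]
      linear_cmul[OF inner_product_linear(2)[OF assms(1)]]
  show "sharp G (l (x + y)) = sharp G (l x) + sharp G (l y)"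
    using linear_add[OF assms(2)]
    by (intro sharp_unique[OF assms(1)]) (simp add: lin sharp_apply[OF assms(1,3)])
  show "sharp G (l (c *\<^sub>R x)) = c *\<^sub>R sharp G (l x)"
    using linear_cmul[OF assms(2)]
    by (intro sharp_unique[OF assms(1)]) (simp add: lin sharp_apply[OF assms(1,3)])
qed

lemma normal_part_unique:
  assumes "inner_product G" "linear A" "w - n \<in> range A" "\<And>v. G n (A v) = 0"
  shows "normal_part G A w = n"
  unfolding normal_part_def
proof (rule the_equality)
  fix n' assume n': "w - n' \<in> range A \<and> (\<forall>v. G n' (A v) = 0)"
  then obtain a b where ab: "w - n = A a" "w - n' = A b" using assms(3) by auto
  then have "n' - n = A (a - b)" by (simp add: linear_diff[OF assms(2)] algebra_simps)
  moreover have "G (n' - n) (A (a - b)) = 0"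
    using linear_diff[OF inner_product_linear(2)[OF assms(1)]] assms(4) n' by simp
  ultimately have "G (n' - n) (n' - n) = 0" by simp
  then show "n' = n" using inner_product_zero_iff[OF assms(1)] by simp
qed (use assms in auto)

lemma normal_part_projection:
  fixes A :: "'e::euclidean_space \<Rightarrow> 'f::euclidean_space"
  assumes "inner_product G" "linear A" "inj A"
  shows "w - normal_part G A w \<in> range A" "G (normal_part G A w) (A v) = 0"
proof -
  \<comment> \<open>\<open>A a\<close> is the tangential part of \<open>w\<close>: \<open>a\<close>
    solves the normal equations, whose form is the pullback of \<open>G\<close>, an inner product
    since \<open>A\<close> is injective.\<close>
  define a where "a = sharp (\<lambda>v w. G (A v) (A w)) (\<lambda>v. G w (A v))"
  have "linear (\<lambda>v. G w (A v))"
    using linear_compose[OF assms(2) inner_product_linear(1)[OF assms(1)]] by (simp add: o_def)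
  then have a: "G (A a) (A v) = G w (A v)" for v
    unfolding a_def by (rule sharp_apply[OF inner_product_pullback[OF assms]])
  then have a0: "G (w - A a) (A v) = 0" for v
    using linear_diff[OF inner_product_linear(2)[OF assms(1)]] by simp
  then have "normal_part G A w = w - A a"
    by (intro normal_part_unique[OF assms(1,2)]) auto
  then show "w - normal_part G A w \<in> range A" "G (normal_part G A w) (A v) = 0"
    using a0 by auto
qed

text \<open>Fits an acceleration of the form "multiple of the vertical field plus a tangent vector",
  of which only the first summand survives.\<close>

lemma normal_part_scale_add_range:
  fixes A :: "'e::euclidean_space \<Rightarrow> 'f::euclidean_space"
  assumes "inner_product G" "linear A" "inj A"
  shows "normal_part G A (c *\<^sub>R w + A v) = c *\<^sub>R normal_part G A w"
proof (rule normal_part_unique[OF assms(1,2)])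
  obtain a where a: "w - normal_part G A w = A a"
    using normal_part_projection(1)[OF assms] by blast
  have "c *\<^sub>R w + A v - c *\<^sub>R normal_part G A w = A (c *\<^sub>R a + v)"
    by (simp add: linear_add[OF assms(2)] linear_cmul[OF assms(2)] a[symmetric] algebra_simps)
  then show "c *\<^sub>R w + A v - c *\<^sub>R normal_part G A w \<in> range A" by simp
  show "G (c *\<^sub>R normal_part G A w) (A z) = 0" for z
    using linear_cmul[OF inner_product_linear(2)[OF assms(1)]] normal_part_projection(2)[OF assms]
    by simp
qed

lemma normal_part_eq_0_iff:
  fixes A :: "'e::euclidean_space \<Rightarrow> 'f::euclidean_space"
  assumes "inner_product G" "linear A" "inj A"
  shows "normal_part G A w = 0 \<longleftrightarrow> w \<in> range A"
proof
  assume "normal_part G A w = 0"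
  then show "w \<in> range A" using normal_part_projection(1)[OF assms, of w] by simp
next
  assume "w \<in> range A"
  then show "normal_part G A w = 0"
    using linear_0[OF inner_product_linear(2)[OF assms(1)]]
    by (intro normal_part_unique[OF assms(1,2)]) auto
qed

lemma normal_part_diff:
  fixes A :: "'e::euclidean_space \<Rightarrow> 'f::euclidean_space"
  assumes "inner_product G" "linear A" "inj A"
  shows "normal_part G A (w - w') = normal_part G A w - normal_part G A w'"
proof (rule normal_part_unique[OF assms(1,2)])
  obtain a a' where a: "w - normal_part G A w = A a" "w' - normal_part G A w' = A a'"
    using normal_part_projection(1)[OF assms] by blast
  have "w - w' - (normal_part G A w - normal_part G A w') = A (a - a')"
    by (simp add: linear_diff[OF assms(2)] a[symmetric] algebra_simps)
  then show "w - w' - (normal_part G A w - normal_part G A w') \<in> range A" by simp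
  show "G (normal_part G A w - normal_part G A w') (A z) = 0" for z
    using linear_diff[OF inner_product_linear(2)[OF assms(1)]] normal_part_projection(2)[OF assms]
    by simp
qed

lemma inner_product_rank_one:
  assumes "inner_product G" "linear l"
  shows "inner_product (\<lambda>v w. G v w + l v * l w)"
proof -
  have "0 < G v v + l v * l v" if "v \<noteq> 0" for v
    using assms(1) that by (simp add: inner_product_def add_pos_nonneg)
  moreover have "linear (\<lambda>w. G v w + l v * l w)" "linear (\<lambda>v. G v w + l v * l w)" for v w
    using inner_product_linear[OF assms(1)] assms(2)
    by (auto intro!: linearI simp: linear_add linear_cmul algebra_simps
        linear_add[OF inner_product_linear(2)[OF assms(1)]] linear_cmul[OF inner_product_linear(2)[OF assms(1)]])
  ultimately show ?thesis
    using inner_product_sym[OF assms(1)] unfolding inner_product_def bilinear_def by (simp add: mult.commute)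
qed

text \<open>The Sherman-Morrison formula for the inverse of a rank one perturbation.\<close>

lemma sharp_rank_one:
  fixes G :: "'e::euclidean_space \<Rightarrow> 'e \<Rightarrow> real"
  assumes "inner_product G" "linear l" "linear m"
  shows "sharp (\<lambda>v w. G v w + l v * l w) m
    = sharp G m - (l (sharp G m) / (1 + l (sharp G l))) *\<^sub>R sharp G l"
proof (rule sharp_unique[OF inner_product_rank_one[OF assms(1,2)]])
  fix w
  have "l (sharp G l) = G (sharp G l) (sharp G l)"
    using assms by (simp add: sharp_apply)
  then have "1 + l (sharp G l) > 0"
    using inner_product_nonneg[OF assms(1)] by (simp add: add_pos_nonneg)
  then show "G (sharp G m - (l (sharp G m) / (1 + l (sharp G l))) *\<^sub>R sharp G l) w
     + l (sharp G m - (l (sharp G m) / (1 + l (sharp G l))) *\<^sub>R sharp G l) * l w = m w"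
    using assms
    by (simp add: linear_diff[OF inner_product_linear(2)[OF assms(1)]]
       linear_cmul[OF inner_product_linear(2)[OF assms(1)]] sharp_apply linear_diff linear_cmul)
     (simp add: field_simps)
qed

text \<open>Symmetry of the inverse metric: both sides are the inner product of the two representing
  vectors.\<close>

lemma apply_sharp_Basis:
  fixes G :: "'e::euclidean_space \<Rightarrow> 'e \<Rightarrow> real"
  assumes "inner_product G" "linear l"
  shows "l (sharp G (\<lambda>w. b \<bullet> w)) = b \<bullet> sharp G l"
proof -
  have "linear (\<lambda>w. b \<bullet> w)" by (simp add: bounded_linear.linear bounded_linear_inner_right)
  then have "G (sharp G (\<lambda>w. b \<bullet> w)) (sharp G l) = b \<bullet> sharp G l"
    using assms by (simp add: sharp_apply)
  moreover have "G (sharp G l) (sharp G (\<lambda>w. b \<bullet> w)) = l (sharp G (\<lambda>w. b \<bullet> w))"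
    using assms by (simp add: sharp_apply)
  ultimately show ?thesis using inner_product_sym[OF assms(1)] by metis
qed

lemma sum_Basis_linear:
  assumes "linear (f :: 'e::euclidean_space \<Rightarrow> real)"
  shows "(\<Sum>b\<in>Basis. (b \<bullet> x) * f b) = f x"
proof -
  have "f x = f (\<Sum>b\<in>Basis. (b \<bullet> x) *\<^sub>R b)"
    by (subst inner_commute) (simp add: euclidean_representation)
  also have "\<dots> = (\<Sum>b\<in>Basis. (b \<bullet> x) * f b)"
    using assms by (simp add: linear_sum linear_cmul)
  finally show ?thesis by simp
qed

text \<open>For each \<open>b\<close> the Sherman-Morrison correction contributes the
  \<open>b\<close>-component of \<open>sharp G l\<close> times \<open>B b (sharp G l)\<close>;
  summed over the basis these reassemble the value of \<open>B\<close> on the diagonal.\<close>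

lemma metric_trace_rank_one:
  fixes G B :: "'e::euclidean_space \<Rightarrow> 'e \<Rightarrow> real"
  assumes "inner_product G" "linear l" "bilinear B"
  shows "metric_trace (\<lambda>v w. G v w + l v * l w) B
    = metric_trace G B - B (sharp G l) (sharp G l) / (1 + l (sharp G l))"
proof -
  let ?X = "sharp G l" and ?c = "1 / (1 + l (sharp G l))"
  have "linear (\<lambda>w. b \<bullet> w)" for b :: 'e
    by (simp add: bounded_linear.linear bounded_linear_inner_right)
  then have "B b (sharp (\<lambda>v w. G v w + l v * l w) (\<lambda>w. b \<bullet> w))
      = B b (sharp G (\<lambda>w. b \<bullet> w)) - ?c * ((b \<bullet> ?X) * B b ?X)" for b
    using assms
    by (simp add: sharp_rank_one apply_sharp_Basis bilinear_rsub bilinear_rmul)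
  then show ?thesis
    using sum_Basis_linear[of "\<lambda>b. B b ?X" ?X] assms(3)
    by (simp add: metric_trace_def sum_subtractf flip: sum_distrib_left sum_divide_distrib)
       (simp add: bilinear_def)
qed

lemma metric_trace_dyad:
  fixes G :: "'e::euclidean_space \<Rightarrow> 'e \<Rightarrow> real"
  assumes "inner_product G" "linear l"
  shows "metric_trace G (\<lambda>v w. l v * l w) = l (sharp G l)"
  using assms sum_Basis_linear[OF assms(2), of "sharp G l"]
  by (simp add: metric_trace_def apply_sharp_Basis mult.commute)

text \<open>The trace over the graph of \<open>V \<circ> r\<close> of the Hessian of \<open>V \<circ> r\<close>, with \<open>p = V''\<close>,
  \<open>q = V'\<close>, \<open>l = dr\<close> and \<open>B\<close> the Hessian of \<open>r\<close>.\<close>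

lemma metric_trace_graph:
  fixes G B :: "'e::euclidean_space \<Rightarrow> 'e \<Rightarrow> real"
  assumes "inner_product G" "linear l" "bilinear B"
  defines "X \<equiv> sharp G l"
  shows "metric_trace (\<lambda>v w. G v w + (q * l v) * (q * l w)) (\<lambda>v w. p * (l v * l w) + q * B v w)
    = p * G X X + q * metric_trace G B
      - q^2 * (p * (G X X)^2 + q * B X X) / (1 + q^2 * G X X)"
proof -
  have lX: "l X = G X X" unfolding X_def using assms by (simp add: sharp_apply)
  have ql: "linear (\<lambda>v. q * l v)"
    using linear_compose_scale_right[OF assms(2), of q] by simp
  have sq: "sharp G (\<lambda>v. q * l v) = q *\<^sub>R X"
    unfolding X_def using assms linear_cmul[OF inner_product_linear(2)[OF assms(1)]]
    by (intro sharp_unique) (simp_all add: sharp_apply)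
  have bil: "bilinear (\<lambda>v w. p * (l v * l w) + q * B v w)"
    using assms(2,3) unfolding bilinear_def
    by (auto intro!: linearI simp: linear_add linear_cmul algebra_simps
       bilinear_ladd[OF assms(3)] bilinear_lmul[OF assms(3)])
  have tr: "metric_trace G (\<lambda>v w. p * (l v * l w) + q * B v w) = p * G X X + q * metric_trace G B"
    using metric_trace_dyad[OF assms(1,2)] lX unfolding X_def metric_trace_def
    by (simp add: sum.distrib flip: sum_distrib_left)
  show ?thesis
    unfolding metric_trace_rank_one[OF assms(1) ql bil] sq tr
    using assms(3) linear_cmul[OF assms(2)]
    by (simp add: lX bilinear_lmul bilinear_rmul power2_eq_square algebra_simps)
qed

section \<open>The Levi-Civita connection in coordinates\<close>

lemma bilinear_Basis_sum:
  fixes F :: "'e::euclidean_space \<Rightarrow> 'e \<Rightarrow> real"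
  assumes "bilinear F"
  shows "F x y = (\<Sum>i\<in>Basis. \<Sum>j\<in>Basis. (x \<bullet> i) * (y \<bullet> j) * F i j)"
proof -
  have l: "linear (F i)" "linear (\<lambda>x. F x y)" for i y using assms by (auto simp: bilinear_def)
  have "F x y = (\<Sum>i\<in>Basis. (x \<bullet> i) * F i y)"
    using sum_Basis_linear[OF l(2), of x y] by (simp add: inner_commute)
  also have "\<dots> = (\<Sum>i\<in>Basis. (x \<bullet> i) * (\<Sum>j\<in>Basis. (y \<bullet> j) * F i j))"
    using sum_Basis_linear[OF l(1), of y] by (simp add: inner_commute)
  finally show ?thesis by (simp add: sum_distrib_left mult.assoc)
qed

text \<open>Not tied to a manifold or a chart, so that it also covers the composite of a metric with
  a transition map. First derivatives suffice for Christoffel symbols.\<close>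

definition metric_on :: "'e::euclidean_space set \<Rightarrow> ('e \<Rightarrow> 'e \<Rightarrow> 'e \<Rightarrow> real) \<Rightarrow> bool" where
  "metric_on S g \<longleftrightarrow> open S \<and> (\<forall>y\<in>S. inner_product (g y)) \<and>
     (\<forall>y\<in>S. \<forall>v w. (\<lambda>p. g p v w) differentiable at y)"

definition metric_deriv :: "('e::euclidean_space \<Rightarrow> 'e \<Rightarrow> 'e \<Rightarrow> real) \<Rightarrow> 'e \<Rightarrow> 'e \<Rightarrow> 'e \<Rightarrow> 'e \<Rightarrow> real" where
  "metric_deriv g y v w u = frechet_derivative (\<lambda>p. g p v w) (at y) u"

text \<open>Christoffel symbols of the first kind: the covector whose index \<open>sharp\<close>
  raises.\<close>

definition koszul :: "('e::euclidean_space \<Rightarrow> 'e \<Rightarrow> 'e \<Rightarrow> real) \<Rightarrow> 'e \<Rightarrow> 'e \<Rightarrow> 'e \<Rightarrow> 'e \<Rightarrow> real" where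
  "koszul g y v w z = (metric_deriv g y w z v + metric_deriv g y v z w - metric_deriv g y v w z) / 2"

lemma christoffel_eq_sharp_koszul:
  "christoffel N i y v w = sharp (metric N i y) (koszul (metric N i) y v w)"
  unfolding christoffel_def koszul_def metric_deriv_def by (rule refl)

lemma metric_on_open: "metric_on S g \<Longrightarrow> open S"
  by (simp add: metric_on_def)

lemma metric_on_inner_product: "metric_on S g \<Longrightarrow> p \<in> S \<Longrightarrow> inner_product (g p)"
  by (simp add: metric_on_def)

lemma metric_on_bilinear: "metric_on S g \<Longrightarrow> p \<in> S \<Longrightarrow> bilinear (g p)"
  by (simp add: metric_on_def inner_product_def)

lemma metric_on_subset: "metric_on S g \<Longrightarrow> open T \<Longrightarrow> T \<subseteq> S \<Longrightarrow> metric_on T g"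
  by (auto simp: metric_on_def)

context
  fixes S :: "'e::euclidean_space set" and g y
  assumes g: "metric_on S g" and y: "y \<in> S"
begin

lemma metric_on_has_derivative: "((\<lambda>p. g p v w) has_derivative metric_deriv g y v w) (at y)"
proof -
  have "(\<lambda>p. g p v w) differentiable at y" using g y by (simp add: metric_on_def)
  then have "((\<lambda>p. g p v w) has_derivative frechet_derivative (\<lambda>p. g p v w) (at y)) (at y)"
    by (rule iffD1[OF frechet_derivative_works])
  then show ?thesis unfolding metric_deriv_def[abs_def] .
qed

lemma metric_derivI:
  assumes "(h has_derivative h') (at y)" "\<And>p. p \<in> S \<Longrightarrow> h p = g p v w"
  shows "metric_deriv g y v w = h'"
proof -
  have "((\<lambda>p. g p v w) has_derivative h') (at y)"
    using assms(1) metric_on_open[OF g] y assms(2) by (rule has_derivative_transform_within_open)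
  from frechet_derivative_at[OF this] show ?thesis
    unfolding metric_deriv_def[abs_def] by (rule sym)
qed

lemma linear_metric_deriv: "linear (metric_deriv g y v w)"
  using metric_on_has_derivative by (rule has_derivative_linear)

lemma metric_deriv_add_left:
  "metric_deriv g y (v + v') w u = metric_deriv g y v w u + metric_deriv g y v' w u"
  by (subst metric_derivI[OF has_derivative_add[OF metric_on_has_derivative metric_on_has_derivative]])
    (simp_all add: bilinear_ladd[OF metric_on_bilinear[OF g]])

lemma metric_deriv_scale_left:
  "metric_deriv g y (c *\<^sub>R v) w u = c * metric_deriv g y v w u"
  by (subst metric_derivI[OF has_derivative_mult_right[OF metric_on_has_derivative]])
    (simp_all add: bilinear_lmul[OF metric_on_bilinear[OF g]])

lemma metric_deriv_commute: "metric_deriv g y v w u = metric_deriv g y w v u"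
  by (subst metric_derivI[OF metric_on_has_derivative, of w v])
    (simp_all add: inner_product_sym[OF metric_on_inner_product[OF g], of _ v])

lemma metric_deriv_add_right:
  "metric_deriv g y v (w + w') u = metric_deriv g y v w u + metric_deriv g y v w' u"
  using metric_deriv_add_left by (simp add: metric_deriv_commute[of v])

lemma metric_deriv_scale_right:
  "metric_deriv g y v (c *\<^sub>R w) u = c * metric_deriv g y v w u"
  using metric_deriv_scale_left by (simp add: metric_deriv_commute[of v])

lemmas metric_deriv_simps =
  metric_deriv_add_left metric_deriv_add_right metric_deriv_scale_left metric_deriv_scale_right
  linear_add[OF linear_metric_deriv] linear_cmul[OF linear_metric_deriv]

lemma bilinear_metric_deriv: "bilinear (\<lambda>v w. metric_deriv g y v w u)"
  unfolding bilinear_def by (auto intro!: linearI simp: metric_deriv_simps)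

lemma linear_koszul:
  "linear (koszul g y v w)" "linear (\<lambda>w. koszul g y v w z)" "linear (\<lambda>v. koszul g y v w z)"
  by (auto intro!: linearI simp: koszul_def[abs_def] metric_deriv_simps field_simps)

lemma sharp_koszul: "g y (sharp (g y) (koszul g y v w)) z = koszul g y v w z"
  by (rule sharp_apply[OF metric_on_inner_product[OF g y] linear_koszul(1)])

lemma bilinear_sharp_koszul: "bilinear (\<lambda>v w. sharp (g y) (koszul g y v w))"
  unfolding bilinear_def
  by (intro conjI allI linear_sharp[OF metric_on_inner_product[OF g y]] linear_koszul)

text \<open>A product rule for three varying factors. Differentiability of the metric is known for
  fixed vectors only, so the vectors are expanded in the basis and the scalar coefficients
  differentiated.\<close>

lemma has_derivative_metric:
  assumes a: "(a has_derivative a') (at y)" and b: "(b has_derivative b') (at y)"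
  shows "((\<lambda>p. g p (a p) (b p)) has_derivative
    (\<lambda>h. metric_deriv g y (a y) (b y) h + g y (a' h) (b y) + g y (a y) (b' h))) (at y)"
proof -
  have "((\<lambda>p. \<Sum>i\<in>Basis. \<Sum>j\<in>Basis. (a p \<bullet> i) * (b p \<bullet> j) * g p i j) has_derivative
      (\<lambda>h. \<Sum>i\<in>Basis. \<Sum>j\<in>Basis. (a y \<bullet> i) * (b y \<bullet> j) * metric_deriv g y i j h
         + ((a y \<bullet> i) * (b' h \<bullet> j) + (a' h \<bullet> i) * (b y \<bullet> j)) * g y i j)) (at y)"
    by (intro has_derivative_sum has_derivative_mult has_derivative_inner_left a b
        metric_on_has_derivative)
  then have "((\<lambda>p. g p (a p) (b p)) has_derivative
      (\<lambda>h. \<Sum>i\<in>Basis. \<Sum>j\<in>Basis. (a y \<bullet> i) * (b y \<bullet> j) * metric_deriv g y i j h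
         + ((a y \<bullet> i) * (b' h \<bullet> j) + (a' h \<bullet> i) * (b y \<bullet> j)) * g y i j)) (at y)"
    using metric_on_open[OF g] y
  proof (rule has_derivative_transform_within_open)
    show "(\<Sum>i\<in>Basis. \<Sum>j\<in>Basis. (a p \<bullet> i) * (b p \<bullet> j) * g p i j) = g p (a p) (b p)"
      if "p \<in> S" for p
      by (rule bilinear_Basis_sum[OF metric_on_bilinear[OF g that], symmetric])
  qed
  moreover have "(\<Sum>i\<in>Basis. \<Sum>j\<in>Basis. (a y \<bullet> i) * (b y \<bullet> j) * metric_deriv g y i j h
         + ((a y \<bullet> i) * (b' h \<bullet> j) + (a' h \<bullet> i) * (b y \<bullet> j)) * g y i j)
      = metric_deriv g y (a y) (b y) h + g y (a' h) (b y) + g y (a y) (b' h)" for h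
    unfolding bilinear_Basis_sum[OF bilinear_metric_deriv, of "a y" "b y"]
      bilinear_Basis_sum[OF metric_on_bilinear[OF g y], of "a' h" "b y"]
      bilinear_Basis_sum[OF metric_on_bilinear[OF g y], of "a y" "b' h"]
    by (simp add: sum.distrib algebra_simps)
  ultimately show ?thesis by simp
qed

text \<open>The squared gradient norm is the maximum over \<open>w\<close> of \<open>2 d\<rho>(w) - g(w, w)\<close>, attained at the
  gradient. Freezing the maximiser at \<open>y\<close> gives a minorant that touches at \<open>y\<close>, so the gradient
  field itself need not be differentiated.\<close>

lemma hessian_gradient_gradient:
  assumes \<rho>: "smooth_on S \<rho>"
    and A: "(A has_real_derivative A') (at (\<rho> y))"
    and eik: "\<And>p. p \<in> S \<Longrightarrow> (let X = sharp (g p) (frechet_derivative \<rho> (at p)) in g p X X) = A (\<rho> p)"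
  defines "X \<equiv> sharp (g y) (frechet_derivative \<rho> (at y))"
  shows "dir_deriv2 \<rho> y X X - frechet_derivative \<rho> (at y) (sharp (g y) (koszul g y X X))
    = A' * g y X X / 2"
proof -
  have D: "(\<rho> has_derivative frechet_derivative \<rho> (at p)) (at p)" if "p \<in> S" for p
    using \<rho> that by (rule smooth_on_has_derivative)
  have lin: "linear (frechet_derivative \<rho> (at p))" if "p \<in> S" for p
    using D[OF that] by (rule has_derivative_linear)
  have X: "g y X w = frechet_derivative \<rho> (at y) w" for w
    unfolding X_def by (rule sharp_apply[OF metric_on_inner_product[OF g y] lin[OF y]])
  define \<psi> where "\<psi> p = A (\<rho> p) - (2 * frechet_derivative \<rho> (at p) X - g p X X)" for p
  have D2: "((\<lambda>p. frechet_derivative \<rho> (at p) X) has_derivative (\<lambda>h. dir_deriv2 \<rho> y h X)) (at y)"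
    unfolding dir_deriv2_def
    by (rule smooth_on_has_derivative[OF smooth_on_frechet_derivative[OF \<rho>] y])
  have A\<rho>: "((\<lambda>p. A (\<rho> p)) has_derivative (\<lambda>h. A' * frechet_derivative \<rho> (at y) h)) (at y)"
    using has_derivative_compose[OF D[OF y] A[unfolded has_field_derivative_def]] .
  have "(\<psi> has_derivative (\<lambda>h. A' * frechet_derivative \<rho> (at y) h
      - (2 * dir_deriv2 \<rho> y h X - metric_deriv g y X X h))) (at y)"
    unfolding \<psi>_def[abs_def]
    by (intro has_derivative_diff has_derivative_mult_right A\<rho> D2 metric_on_has_derivative)
  moreover have "\<psi> y = 0"
    using eik[OF y] X[of X] by (simp add: \<psi>_def Let_def X_def[symmetric])
  moreover have "0 \<le> \<psi> p" if "p \<in> S" for p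
  proof -
    define Y where "Y = sharp (g p) (frechet_derivative \<rho> (at p))"
    note ip = metric_on_inner_product[OF g that] and bil = metric_on_bilinear[OF g that]
    have Y: "g p Y w = frechet_derivative \<rho> (at p) w" for w
      unfolding Y_def by (rule sharp_apply[OF ip lin[OF that]])
    have "0 \<le> g p (Y - X) (Y - X)" by (rule inner_product_nonneg[OF ip])
    also have "\<dots> = g p Y Y - 2 * g p Y X + g p X X"
      using inner_product_sym[OF ip, of X Y] by (simp add: bilinear_lsub[OF bil] bilinear_rsub[OF bil])
    finally show ?thesis
      using eik[OF that] Y[of X] by (simp add: \<psi>_def Let_def Y_def[symmetric])
  qed
  ultimately have "(\<lambda>h. A' * frechet_derivative \<rho> (at y) h
      - (2 * dir_deriv2 \<rho> y h X - metric_deriv g y X X h)) = (\<lambda>h. 0)"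
    using differential_zero_maxmin[OF y metric_on_open[OF g]] by simp
  from fun_cong[OF this, of X]
  have "A' * g y X X = 2 * dir_deriv2 \<rho> y X X - metric_deriv g y X X X"
    using X[of X] by simp
  moreover have "frechet_derivative \<rho> (at y) (sharp (g y) (koszul g y X X)) = metric_deriv g y X X X / 2"
    using sharp_koszul[of X X X] inner_product_sym[OF metric_on_inner_product[OF g y]]
    by (simp add: X[symmetric] koszul_def)
  ultimately show ?thesis by simp
qed

end

section \<open>Second derivatives and change of charts\<close>

lemma dir_deriv2_has_derivative:
  assumes "smooth_on S f" "x \<in> S"
  shows "((\<lambda>z. frechet_derivative f (at z) w) has_derivative (\<lambda>v. dir_deriv2 f x v w)) (at x)"
  unfolding dir_deriv2_def
  by (rule smooth_on_has_derivative[OF smooth_on_frechet_derivative[OF assms(1)] assms(2)])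

text \<open>In \<open>v\<close> the map is itself a derivative; in \<open>w\<close> the first
  derivative is linear at every nearby point, and this survives differentiation.\<close>

lemma linear_dir_deriv2:
  assumes "open S" "smooth_on S f" "x \<in> S"
  shows "linear (\<lambda>v. dir_deriv2 f x v w)" "linear (\<lambda>w. dir_deriv2 f x v w)"
proof -
  have D: "(f has_derivative frechet_derivative f (at z)) (at z)" if "z \<in> S" for z
    using assms(2) that by (rule smooth_on_has_derivative)
  show "linear (\<lambda>v. dir_deriv2 f x v w)"
    using dir_deriv2_has_derivative[OF assms(2,3)] by (rule has_derivative_linear)
  have eqI: "dir_deriv2 f x v w = h' v"
    if "(h has_derivative h') (at x)" "\<And>z. z \<in> S \<Longrightarrow> h z = frechet_derivative f (at z) w" for h h' w
  proof -
    have "((\<lambda>z. frechet_derivative f (at z) w) has_derivative h') (at x)"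
      using that(1) assms(1,3) that(2) by (rule has_derivative_transform_within_open)
    from frechet_derivative_at[OF this] show ?thesis unfolding dir_deriv2_def by simp
  qed
  show "linear (\<lambda>w. dir_deriv2 f x v w)"
  proof (rule linearI)
    fix w w' c
    show "dir_deriv2 f x v (w + w') = dir_deriv2 f x v w + dir_deriv2 f x v w'"
      by (rule eqI[OF has_derivative_add[OF dir_deriv2_has_derivative[OF assms(2,3)]
              dir_deriv2_has_derivative[OF assms(2,3)]]])
        (simp add: linear_add[OF has_derivative_linear[OF D]])
    show "dir_deriv2 f x v (c *\<^sub>R w) = c *\<^sub>R dir_deriv2 f x v w"
      by (rule eqI[OF has_derivative_scaleR_right[OF dir_deriv2_has_derivative[OF assms(2,3)]]])
        (simp add: linear_cmul[OF has_derivative_linear[OF D]])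
  qed
qed

text \<open>The inhomogeneous transformation law of the Christoffel symbols, obtained by
  differentiating the isometry relation \<open>iso\<close>.\<close>

lemma sharp_koszul_transform:
  fixes \<tau> :: "'e::euclidean_space \<Rightarrow> 'e"
  assumes "metric_on S g" "metric_on T h" "y \<in> S"
    and \<tau>: "smooth_on S \<tau>" "\<tau> ` S \<subseteq> T"
    and iso: "\<And>p v w. p \<in> S \<Longrightarrow>
       g p v w = h (\<tau> p) (frechet_derivative \<tau> (at p) v) (frechet_derivative \<tau> (at p) w)"
  defines "L \<equiv> frechet_derivative \<tau> (at y)"
  shows "L (sharp (g y) (koszul g y v w))
    = dir_deriv2 \<tau> y v w + sharp (h (\<tau> y)) (koszul h (\<tau> y) (L v) (L w))"
proof -
  have "open S" using assms(1) by (simp add: metric_on_def)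
  have \<tau>T: "\<tau> p \<in> T" if "p \<in> S" for p using \<tau>(2) that by blast
  have D\<tau>: "(\<tau> has_derivative frechet_derivative \<tau> (at p)) (at p)" if "p \<in> S" for p
    using \<tau>(1) that by (rule smooth_on_has_derivative)
  have linL: "linear L" unfolding L_def using D\<tau>[OF assms(3)] by (rule has_derivative_linear)
  \<comment> \<open>Separates the two ways in which the right side of \<open>iso\<close> depends on
    \<open>p\<close>: through the base point, handled by \<open>h'\<close>, and through the
    transported vectors.\<close>
  define h' where "h' p = h (\<tau> p)" for p
  have D: "((\<lambda>p. h' p v w) has_derivative (\<lambda>u. metric_deriv h (\<tau> p) v w (frechet_derivative \<tau> (at p) u))) (at p)"
    if "p \<in> S" for p v w
    unfolding h'_def
    by (rule has_derivative_compose[OF D\<tau>[OF that] metric_on_has_derivative[OF assms(2) \<tau>T[OF that]]])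
  have m': "metric_on S h'"
    unfolding metric_on_def h'_def[abs_def]
  proof (intro conjI ballI allI)
    show "open S" by fact
    show "inner_product (h (\<tau> p))" if "p \<in> S" for p
      by (rule metric_on_inner_product[OF assms(2) \<tau>T[OF that]])
    show "(\<lambda>p. h (\<tau> p) v w) differentiable at p" if "p \<in> S" for p v w
      using D[OF that] unfolding h'_def by (rule differentiableI)
  qed
  have d': "metric_deriv h' y v w u = metric_deriv h (\<tau> y) v w (L u)" for v w u
    unfolding L_def using metric_derivI[OF m' assms(3) D[OF assms(3)], of v w v w]
    by simp
  have dg: "metric_deriv g y v w u = metric_deriv h (\<tau> y) (L v) (L w) (L u)
     + h (\<tau> y) (dir_deriv2 \<tau> y u v) (L w) + h (\<tau> y) (L v) (dir_deriv2 \<tau> y u w)" for v w u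
  proof -
    have "metric_deriv g y v w = (\<lambda>u. metric_deriv h' y (L v) (L w) u
       + h' y (dir_deriv2 \<tau> y u v) (L w) + h' y (L v) (dir_deriv2 \<tau> y u w))"
      unfolding L_def
      by (rule metric_derivI[OF assms(1,3) has_derivative_metric[OF m' assms(3)
            dir_deriv2_has_derivative[OF \<tau>(1) assms(3)] dir_deriv2_has_derivative[OF \<tau>(1) assms(3)]]])
        (simp add: iso h'_def)
    then show ?thesis by (simp add: d') (simp add: h'_def)
  qed
  note ip = metric_on_inner_product[OF assms(2) \<tau>T[OF assms(3)]]
  have bil: "bilinear (h (\<tau> y))" using ip by (simp add: inner_product_def)
  have sym: "dir_deriv2 \<tau> y u u' = dir_deriv2 \<tau> y u' u" for u u'
    by (rule dir_deriv2_symmetric[OF \<open>open S\<close> \<tau>(1) assms(3)])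
  \<comment> \<open>Each metric derivative brings two second derivatives of \<tau>. By symmetry
    those along \<open>v, z\<close> and along \<open>w, z\<close> cancel, and the two along
    \<open>v, w\<close> add up against the factor 1/2.\<close>
  have "koszul g y v w z = koszul h (\<tau> y) (L v) (L w) (L z) + h (\<tau> y) (dir_deriv2 \<tau> y v w) (L z)" for z
    unfolding koszul_def dg
    using sym[of w v] sym[of z v] sym[of z w] inner_product_sym[OF ip]
    by (simp add: field_simps)
  then have *: "h (\<tau> y) (L (sharp (g y) (koszul g y v w))) (L z)
     = h (\<tau> y) (dir_deriv2 \<tau> y v w + sharp (h (\<tau> y)) (koszul h (\<tau> y) (L v) (L w))) (L z)" for z
    using sharp_koszul[OF assms(1,3), of v w z] sharp_koszul[OF assms(2) \<tau>T[OF assms(3)], of "L v" "L w" "L z"]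
    by (simp add: iso[OF assms(3)] L_def[symmetric] bilinear_ladd[OF bil])
  \<comment> \<open>A vector killed by \<open>L\<close> has zero \<open>g\<close>-length.\<close>
  have "inj L"
  proof (rule injI)
    fix a b assume "L a = L b"
    then have "g y (a - b) (a - b) = 0"
      using linear_diff[OF linL] by (simp add: iso[OF assms(3)] L_def[symmetric] bilinear_lzero[OF bil])
    then show "a = b"
      using inner_product_zero_iff[OF metric_on_inner_product[OF assms(1,3)]] by simp
  qed
  \<comment> \<open>Domain and codomain have the same dimension, so the vectors \<open>L z\<close>
    against which the identity was tested are all vectors.\<close>
  then have "surj L" using linL by (simp add: linear_injective_imp_surjective)
  have "sharp (h (\<tau> y)) (h (\<tau> y) (L (sharp (g y) (koszul g y v w)))) = L (sharp (g y) (koszul g y v w))"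
    by (rule sharp_unique[OF ip]) (rule refl)
  moreover have "sharp (h (\<tau> y)) (h (\<tau> y) (L (sharp (g y) (koszul g y v w))))
     = dir_deriv2 \<tau> y v w + sharp (h (\<tau> y)) (koszul h (\<tau> y) (L v) (L w))"
  proof (rule sharp_unique[OF ip])
    fix w'
    obtain z where "w' = L z" using \<open>surj L\<close> by (rule surjE)
    then show "h (\<tau> y) (dir_deriv2 \<tau> y v w + sharp (h (\<tau> y)) (koszul h (\<tau> y) (L v) (L w))) w'
       = h (\<tau> y) (L (sharp (g y) (koszul g y v w))) w'" by (simp add: *)
  qed
  ultimately show ?thesis by simp
qed

section \<open>Composition with functions of one real variable\<close>

lemma smooth_on_cong:
  "open S \<Longrightarrow> smooth_on S f \<Longrightarrow> (\<And>x. x \<in> S \<Longrightarrow> f x = g x) \<Longrightarrow> smooth_on S g"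
  unfolding smooth_on_def by (intro allI) (rule Ck_on_cong, assumption, erule spec)

lemma smooth_on_has_real_derivative:
  fixes W :: "real \<Rightarrow> real"
  assumes "smooth_on U W" "s \<in> U"
  shows "(W has_real_derivative deriv W s) (at s)"
proof -
  have D: "(W has_derivative frechet_derivative W (at s)) (at s)"
    using assms by (rule smooth_on_has_derivative)
  then have "(W has_derivative (\<lambda>a. frechet_derivative W (at s) 1 * a)) (at s)"
  proof (rule has_derivative_eq_rhs, intro ext)
    show "frechet_derivative W (at s) a = frechet_derivative W (at s) 1 * a" for a
      by (subst linear_real_apply[OF has_derivative_linear[OF D]]) simp
  qed
  then have "(W has_real_derivative frechet_derivative W (at s) 1) (at s)"
    by (simp add: has_field_derivative_def)
  then show ?thesis by (simp add: DERIV_imp_deriv)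
qed

lemma smooth_on_deriv:
  fixes W :: "real \<Rightarrow> real"
  assumes "open U" "smooth_on U W"
  shows "smooth_on U (deriv W)"
  using assms(1) smooth_on_frechet_derivative[OF assms(2), of 1]
proof (rule smooth_on_cong)
  fix s assume "s \<in> U"
  from smooth_on_has_real_derivative[OF assms(2) this, unfolded has_field_derivative_def]
  have "(*) (deriv W s) = frechet_derivative W (at s)" by (rule frechet_derivative_at)
  from fun_cong[OF this, of 1] show "frechet_derivative W (at s) 1 = deriv W s" by simp
qed

lemma compose_real_has_derivative:
  fixes W :: "real \<Rightarrow> real" and \<rho> :: "'e::real_normed_vector \<Rightarrow> real"
  assumes "smooth_on S \<rho>" "smooth_on U W" "y \<in> S" "\<rho> y \<in> U"
  shows "((\<lambda>p. W (\<rho> p)) has_derivative (\<lambda>v. deriv W (\<rho> y) * frechet_derivative \<rho> (at y) v)) (at y)"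
  using smooth_on_has_derivative[OF assms(1,3)]
    smooth_on_has_real_derivative[OF assms(2,4), unfolded has_field_derivative_def]
  by (rule has_derivative_compose)

lemma dir_deriv2_compose_real:
  fixes W :: "real \<Rightarrow> real" and \<rho> :: "'e::real_normed_vector \<Rightarrow> real"
  assumes "open S" "smooth_on S \<rho>" "open U" "smooth_on U W" "\<rho> ` S \<subseteq> U" "y \<in> S"
  shows "dir_deriv2 (\<lambda>p. W (\<rho> p)) y v w
      = deriv (deriv W) (\<rho> y) * (frechet_derivative \<rho> (at y) v * frechet_derivative \<rho> (at y) w)
        + deriv W (\<rho> y) * dir_deriv2 \<rho> y v w"
proof -
  have \<rho>U: "\<rho> p \<in> U" if "p \<in> S" for p using assms(5) that by blast
  have "((\<lambda>p. deriv W (\<rho> p) * frechet_derivative \<rho> (at p) w) has_derivative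
     (\<lambda>v. deriv W (\<rho> y) * dir_deriv2 \<rho> y v w
       + deriv (deriv W) (\<rho> y) * frechet_derivative \<rho> (at y) v * frechet_derivative \<rho> (at y) w)) (at y)"
    by (intro has_derivative_mult dir_deriv2_has_derivative[OF assms(2,6)]
        compose_real_has_derivative[OF assms(2) smooth_on_deriv[OF assms(3,4)] assms(6) \<rho>U[OF assms(6)]])
  then have "((\<lambda>p. frechet_derivative (\<lambda>p. W (\<rho> p)) (at p) w) has_derivative
     (\<lambda>v. deriv W (\<rho> y) * dir_deriv2 \<rho> y v w
       + deriv (deriv W) (\<rho> y) * frechet_derivative \<rho> (at y) v * frechet_derivative \<rho> (at y) w)) (at y)"
    using assms(1,6)
  proof (rule has_derivative_transform_within_open)
    show "deriv W (\<rho> p) * frechet_derivative \<rho> (at p) w = frechet_derivative (\<lambda>p. W (\<rho> p)) (at p) w"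
      if "p \<in> S" for p
      using fun_cong[OF frechet_derivative_at[OF compose_real_has_derivative[OF assms(2,4) that \<rho>U[OF that]]]] .
  qed
  from fun_cong[OF frechet_derivative_at[OF this], of v] show ?thesis
    unfolding dir_deriv2_def[of "\<lambda>p. W (\<rho> p)"] by simp
qed

lemma smooth_on_compose_real:
  fixes W :: "real \<Rightarrow> real"
  assumes "open S" "open U" "smooth_on U W" "smooth_on S \<rho>" "\<rho> ` S \<subseteq> U"
  shows "smooth_on S (\<lambda>p. W (\<rho> p))"
  unfolding smooth_on_def
proof
  fix k
  show "Ck_on k S (\<lambda>p. W (\<rho> p))"
  proof (rule Ck_on_compose_real[where W = W and f = \<rho>, OF assms(1,2)])
    show "Ck_on k U W" "Ck_on k S \<rho>"
      using assms(3,4) by (simp_all add: smooth_on_def)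
  qed fact
qed

text \<open>At an isolated point of \<open>J\<close> the filter is trivial and every number is a
  derivative; at a limit point the derivative within \<open>J\<close> is unique, hence that of any
  differentiable extension.\<close>

lemma deriv_on_eq:
  assumes "s islimpt J" "s \<in> J" "\<And>t. t \<in> J \<Longrightarrow> V t = W t" "(W has_real_derivative D) (at s)"
  shows "deriv_on J V s = D"
proof -
  have "(W has_derivative (\<lambda>h. h *\<^sub>R D)) (at s within J)"
    using has_field_derivative_at_within[OF assms(4), of J]
    by (simp add: has_real_derivative_iff_has_vector_derivative has_vector_derivative_def)
  from has_derivative_transform[OF assms(2,3) this]
  have "(V has_derivative (\<lambda>h. h *\<^sub>R D)) (at s within J)" .
  then have "(V has_vector_derivative D) (at s within J)"
    by (simp add: has_vector_derivative_def)
  moreover have "at s within J \<noteq> bot" using assms(1) by (simp add: trivial_limit_within)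
  ultimately show ?thesis unfolding deriv_on_def by (intro vector_derivative_within)
qed

text \<open>After clearing the denominator, positive since \<open>0 \<le> a\<close>, the two terms
  \<open>p * q^2 * a^2\<close> cancel, so the second derivative keeps only a multiple of
  \<open>a\<close> as coefficient. The overall factor 2 removes the half from the Hessian
  term.\<close>

lemma soliton_equation_algebra:
  fixes a a' b p q :: real
  assumes "0 \<le> a"
  shows "p * a + q * b - q^2 * (p * a^2 + q * (a' * a / 2)) / (1 + q^2 * a) = 1
    \<longleftrightarrow> 2 * a * p - a * (a' - 2 * b) * q ^ 3 - 2 * a * q^2 + 2 * b * q - 2 = 0"
proof -
  have "1 + q^2 * a > 0" using assms by (simp add: add_pos_nonneg)
  then have ne: "1 + q^2 * a \<noteq> 0" by simp
  have div: "x - y / z = 1 \<longleftrightarrow> (x - 1) * z - y = 0" if "z \<noteq> 0" for x y z :: real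
    using that by (auto simp: field_simps)
  have "p * a + q * b - q^2 * (p * a^2 + q * (a' * a / 2)) / (1 + q^2 * a) = 1
    \<longleftrightarrow> (p * a + q * b - 1) * (1 + q^2 * a) - q^2 * (p * a^2 + q * (a' * a / 2)) = 0"
    by (rule div[OF ne])
  moreover have "2 * a * p - a * (a' - 2 * b) * q ^ 3 - 2 * a * q^2 + 2 * b * q - 2
    = 2 * ((p * a + q * b - 1) * (1 + q^2 * a) - q^2 * (p * a^2 + q * (a' * a / 2)))"
    by (simp add: algebra_simps power2_eq_square power3_eq_cube)
  ultimately show ?thesis by simp
qed

section \<open>Charts and product manifolds\<close>

lemma riemannian_manifoldD:
  assumes "riemannian_manifold N"
  shows "(\<Union>i. chart_dom N i) = UNIV"
    and "open (chart_dom N i)" "open (chart N i ` chart_dom N i)"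
    and "homeomorphism (chart_dom N i) (chart N i ` chart_dom N i) (chart N i) (cinv N i)"
    and "smooth_on (chart N i ` (chart_dom N i \<inter> chart_dom N j)) (transition N i j)"
    and "\<And>y. y \<in> chart N i ` chart_dom N i \<Longrightarrow> inner_product (metric N i y)"
    and "smooth_on (chart N i ` chart_dom N i) (\<lambda>y. metric N i y v w)"
    and "\<And>y. y \<in> chart N i ` (chart_dom N i \<inter> chart_dom N j) \<Longrightarrow>
        metric N i y v w =
        metric N j (transition N i j y)
          (frechet_derivative (transition N i j) (at y) v)
          (frechet_derivative (transition N i j) (at y) w)"
  using assms by (auto simp only: riemannian_manifold_def)

lemma cinv_chart:
  assumes "riemannian_manifold N" "x \<in> chart_dom N i"
  shows "cinv N i (chart N i x) = x"
  using riemannian_manifoldD(4)[OF assms(1), of i] assms(2) by (simp add: homeomorphism_def)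

lemma open_chart_image:
  assumes "riemannian_manifold N" "open A" "A \<subseteq> chart_dom N i"
  shows "open (chart N i ` A)"
proof -
  have "openin (top_of_set (chart_dom N i)) A"
    using assms riemannian_manifoldD(2)[OF assms(1)] by (simp add: openin_open_eq)
  then have "openin (top_of_set (chart N i ` chart_dom N i)) (chart N i ` A)"
    by (rule homeomorphism_imp_open_map[OF riemannian_manifoldD(4)[OF assms(1)]])
  then show ?thesis
    using riemannian_manifoldD(3)[OF assms(1)] by (rule openin_open_trans)
qed

lemma metric_on_chart:
  assumes "riemannian_manifold N"
  shows "metric_on (chart N i ` chart_dom N i) (metric N i)"
  unfolding metric_on_def
proof (intro conjI ballI allI)
  show "(\<lambda>p. metric N i p v w) differentiable at y" if "y \<in> chart N i ` chart_dom N i" for y v w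
    using riemannian_manifoldD(7)[OF assms] that by (rule smooth_on_differentiable)
qed (use riemannian_manifoldD[OF assms] in auto)

text \<open>Serves to make the image of \<open>M\<close> under \<open>r\<close> connected and the
  height function continuous.\<close>

lemma continuous_on_smooth_fun:
  assumes "riemannian_manifold N" "smooth_fun N r"
  shows "continuous_on UNIV r"
proof -
  have "continuous_on (chart_dom N i) r" for i
  proof -
    have "continuous_on (chart N i ` chart_dom N i) (r \<circ> cinv N i)"
      using assms(2) unfolding smooth_fun_def by (intro smooth_on_continuous_on) (erule spec)
    moreover have "continuous_on (chart_dom N i) (chart N i)"
      using riemannian_manifoldD(4)[OF assms(1), of i] by (simp add: homeomorphism_def)
    ultimately have "continuous_on (chart_dom N i) ((r \<circ> cinv N i) \<circ> chart N i)"
      by (rule continuous_on_compose[rotated])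
    then show ?thesis
      by (rule continuous_on_eq) (simp add: cinv_chart[OF assms(1)])
  qed
  then have "continuous_on (\<Union>i\<in>UNIV. chart_dom N i) r"
    using riemannian_manifoldD(2)[OF assms(1)] by (intro continuous_on_open_UN) auto
  then show ?thesis using riemannian_manifoldD(1)[OF assms(1)] by simp
qed

lemma prod_line_simps [simp]:
  "chart_dom (prod_line N) i = chart_dom N i \<times> UNIV"
  "chart (prod_line N) i (x, s) = (chart N i x, s)"
  "metric (prod_line N) i (y, s) (v, a) (w, b) = metric N i y v w + a * b"
  by (simp_all add: prod_line_def)

lemma inner_product_prod_line:
  assumes "inner_product (metric N i y)"
  shows "inner_product (metric (prod_line N) i (y, s))"
proof -
  note lin = linear_add[OF inner_product_linear(1)[OF assms]] linear_add[OF inner_product_linear(2)[OF assms]]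
    linear_cmul[OF inner_product_linear(1)[OF assms]] linear_cmul[OF inner_product_linear(2)[OF assms]]
  have "bilinear (metric (prod_line N) i (y, s))"
    unfolding bilinear_def by (auto intro!: linearI simp: lin algebra_simps)
  moreover have "0 < metric N i y v v + a * a" if "(v, a) \<noteq> 0" for v a
    using that assms inner_product_zero_iff[OF assms, of v] unfolding inner_product_def
    by (cases "v = 0") (auto simp: zero_prod_def add_pos_nonneg zero_less_mult_iff linorder_neq_iff)
  ultimately show ?thesis
    using inner_product_sym[OF assms] unfolding inner_product_def by (auto simp: mult.commute)
qed

text \<open>The product metric does not depend on the height and is constant on the line factor, so
  its Koszul covector sees only the components in \<open>N\<close>.\<close>

lemma christoffel_prod_line:
  assumes "riemannian_manifold N" "y \<in> chart N i ` chart_dom N i"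
  shows "christoffel (prod_line N) i (y, s) (v, a) (w, b) = (christoffel N i y v w, 0)"
proof -
  note g = metric_on_chart[OF assms(1), of i]
  have D: "metric_deriv (metric (prod_line N) i) (y, s) (v, a) (w, b) (z, c) = metric_deriv (metric N i) y v w z"
    for v a w b z c
  proof -
    have "((\<lambda>p. metric N i (fst p) v w + a * b) has_derivative (\<lambda>u. metric_deriv (metric N i) y v w (fst u) + 0)) (at (y, s))"
    proof (intro has_derivative_add has_derivative_const)
      have "(fst has_derivative fst) (at (y, s))"
        by (intro bounded_linear_imp_has_derivative bounded_linear_fst)
      moreover have "((\<lambda>p. metric N i p v w) has_derivative metric_deriv (metric N i) y v w) (at (fst (y, s)))"
        using metric_on_has_derivative[OF g assms(2)] by simp
      ultimately show "((\<lambda>p. metric N i (fst p) v w) has_derivative (\<lambda>u. metric_deriv (metric N i) y v w (fst u))) (at (y, s))"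
        by (rule has_derivative_compose)
    qed
    moreover have "(\<lambda>p. metric (prod_line N) i p (v, a) (w, b)) = (\<lambda>p. metric N i (fst p) v w + a * b)"
      by auto
    ultimately have "((\<lambda>p. metric (prod_line N) i p (v, a) (w, b)) has_derivative
        (\<lambda>u. metric_deriv (metric N i) y v w (fst u) + 0)) (at (y, s))" by simp
    from fun_cong[OF frechet_derivative_at[OF this], of "(z, c)"] show ?thesis
      by (simp add: metric_deriv_def)
  qed
  show ?thesis
    unfolding christoffel_eq_sharp_koszul
  proof (rule sharp_unique[OF inner_product_prod_line[OF metric_on_inner_product[OF g assms(2)]]])
    fix z :: "'c \<times> real"
    show "metric (prod_line N) i (y, s) (sharp (metric N i y) (koszul (metric N i) y v w), 0) z
       = koszul (metric (prod_line N) i) (y, s) (v, a) (w, b) z"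
      using sharp_koszul[OF g assms(2), of v w "fst z"]
      by (cases z) (simp add: koszul_def D)
  qed
qed

text \<open>Shaped for the local representative of a vertically shifted graph: a transition map
  paired with a height, where the shift \<open>c\<close> drops out of all derivatives.\<close>

lemma has_derivative_Pair_dir_deriv2:
  assumes "open S" "smooth_on S f" "smooth_on S h" "y \<in> S"
    and F: "\<And>p. p \<in> S \<Longrightarrow> F p = (f p, h p + c)"
  shows "frechet_derivative F (at y) = (\<lambda>v. (frechet_derivative f (at y) v, frechet_derivative h (at y) v))"
    and "dir_deriv2 F y v w = (dir_deriv2 f y v w, dir_deriv2 h y v w)"
proof -
  have D: "frechet_derivative F (at p) = (\<lambda>v. (frechet_derivative f (at p) v, frechet_derivative h (at p) v))"
    if "p \<in> S" for p
  proof -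
    have "((\<lambda>p. (f p, h p + c)) has_derivative
        (\<lambda>v. (frechet_derivative f (at p) v, frechet_derivative h (at p) v + 0))) (at p)"
      by (intro has_derivative_Pair has_derivative_add has_derivative_const
          smooth_on_has_derivative[OF assms(2) that] smooth_on_has_derivative[OF assms(3) that])
    then have "(F has_derivative
        (\<lambda>v. (frechet_derivative f (at p) v, frechet_derivative h (at p) v + 0))) (at p)"
      using assms(1) that F[symmetric] by (rule has_derivative_transform_within_open)
    from frechet_derivative_at[OF this] show ?thesis by simp
  qed
  show "frechet_derivative F (at y) = (\<lambda>v. (frechet_derivative f (at y) v, frechet_derivative h (at y) v))"
    by (rule D[OF assms(4)])
  have "((\<lambda>p. (frechet_derivative f (at p) w, frechet_derivative h (at p) w)) has_derivative
      (\<lambda>v. (dir_deriv2 f y v w, dir_deriv2 h y v w))) (at y)"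
    by (intro has_derivative_Pair dir_deriv2_has_derivative[OF assms(2,4)] dir_deriv2_has_derivative[OF assms(3,4)])
  then have "((\<lambda>p. frechet_derivative F (at p) w) has_derivative
      (\<lambda>v. (dir_deriv2 f y v w, dir_deriv2 h y v w))) (at y)"
    using assms(1,4) by (rule has_derivative_transform_within_open) (simp add: D)
  from fun_cong[OF frechet_derivative_at[OF this], of v]
  show "dir_deriv2 F y v w = (dir_deriv2 f y v w, dir_deriv2 h y v w)"
    unfolding dir_deriv2_def[of F] by simp
qed

section \<open>Graphs over an isoparametric function\<close>

text \<open>\<open>W\<close> is a smooth extension of \<open>V\<close> and \<open>A\<close> one of \<open>\<alpha>\<close>.\<close>

locale isoparametric_graph =
  fixes N :: "('i, 'a::{t2_space, second_countable_topology}, 'e::euclidean_space) riem"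
    and r :: "'a \<Rightarrow> real" and \<alpha> \<beta> :: "real \<Rightarrow> real" and M :: "'a set"
    and UA UW :: "real set" and A W :: "real \<Rightarrow> real"
  assumes riem: "riemannian_manifold N"
    and iso: "isoparametric N r \<alpha> \<beta>"
    and open_M: "open M"
    and UA: "range r \<subseteq> UA" "smooth_on UA A" "\<And>s. s \<in> range r \<Longrightarrow> A s = \<alpha> s"
    and UW: "open UW" "r ` M \<subseteq> UW" "smooth_on UW W"
begin

lemma smooth_fun_r: "smooth_fun N r"
  using iso by (simp add: isoparametric_def)

text \<open>A graph point over \<open>x\<close> lies in chart \<open>j\<close> of the product
  exactly when \<open>x\<close> lies in chart \<open>j\<close> of \<open>N\<close>; this is
  therefore the domain of the local representative of the graph for the charts \<open>i\<close> and
  \<open>j\<close>.\<close>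

definition overlap :: "'i \<Rightarrow> 'i \<Rightarrow> 'e set" where
  "overlap i j = chart N i ` (M \<inter> chart_dom N i \<inter> chart_dom N j)"

lemma open_overlap: "open (overlap i j)"
  unfolding overlap_def
  by (intro open_chart_image[OF riem] open_Int open_M riemannian_manifoldD(2)[OF riem]) auto

lemma overlap_subset: "overlap i j \<subseteq> chart N i ` chart_dom N i"
  "overlap i j \<subseteq> chart N i ` (chart_dom N i \<inter> chart_dom N j)"
  by (auto simp: overlap_def)

lemma cinv_overlap:
  assumes "p \<in> overlap i j"
  shows "cinv N i p \<in> M" "cinv N i p \<in> chart_dom N i" "cinv N i p \<in> chart_dom N j"
    "chart N i (cinv N i p) = p"
  using assms cinv_chart[OF riem] by (auto simp: overlap_def)

lemma metric_on_overlap: "metric_on (overlap i j) (metric N i)"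
  by (rule metric_on_subset[OF metric_on_chart[OF riem] open_overlap overlap_subset(1)])

lemma smooth_on_r: "smooth_on (overlap i j) (r \<circ> cinv N i)"
  using smooth_fun_r unfolding smooth_fun_def
  by (intro smooth_on_subset[OF _ overlap_subset(1)]) (erule spec)

lemma r_overlap: "(r \<circ> cinv N i) ` overlap i j \<subseteq> UW"
  using cinv_overlap(1) UW(2) by auto

lemma smooth_on_transition: "smooth_on (overlap i j) (transition N i j)"
  by (rule smooth_on_subset[OF riemannian_manifoldD(5)[OF riem] overlap_subset(2)])

lemma smooth_on_height: "smooth_on (overlap i j) (\<lambda>p. W ((r \<circ> cinv N i) p))"
  by (rule smooth_on_compose_real[OF open_overlap UW(1,3) smooth_on_r r_overlap])

lemma transition_isometry:
  assumes "p \<in> overlap i j"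
  shows "metric N i p v w = metric N j (transition N i j p)
     (frechet_derivative (transition N i j) (at p) v) (frechet_derivative (transition N i j) (at p) w)"
  using assms overlap_subset(2) by (intro riemannian_manifoldD(8)[OF riem]) auto

lemma eikonal:
  assumes "x \<in> chart_dom N i"
  shows "metric N i (chart N i x) (gradient N r i x) (gradient N r i x) = \<alpha> (r x)"
    "laplacian N r i x = \<beta> (r x)"
  using iso assms unfolding isoparametric_def by auto

text \<open>The trace T as a function of the value \<open>s\<close> of \<open>r\<close>. The
  derivatives are those of the extensions \<open>W\<close> and \<open>A\<close>, hence ordinary
  two-sided ones.\<close>

definition curvature_coeff :: "real \<Rightarrow> real" where
  "curvature_coeff s =
    (let p = deriv (deriv W) s; q = deriv W s; a = \<alpha> s; b = \<beta> s; a' = deriv A s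
     in p * a + q * b - q^2 * (p * a^2 + q * (a' * a / 2)) / (1 + q^2 * a))"

lemma bilinear_hessian:
  assumes "x \<in> M" "x \<in> chart_dom N i"
  shows "bilinear (hessian N r i x)"
proof -
  have y: "chart N i x \<in> overlap i i" using assms by (auto simp: overlap_def)
  note D = smooth_on_has_derivative[OF smooth_on_r y]
  note lin = linear_dir_deriv2[OF open_overlap smooth_on_r y]
  note chr = bilinear_sharp_koszul[OF metric_on_overlap y]
  show ?thesis
    unfolding bilinear_def hessian_def[abs_def] christoffel_eq_sharp_koszul
    by (auto intro!: linearI simp: linear_add[OF lin(1)] linear_add[OF lin(2)] linear_cmul[OF lin(1)]
        linear_cmul[OF lin(2)] bilinear_ladd[OF chr] bilinear_radd[OF chr] bilinear_lmul[OF chr]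
        bilinear_rmul[OF chr] linear_add[OF has_derivative_linear[OF D]]
        linear_cmul[OF has_derivative_linear[OF D]] algebra_simps)
qed

text \<open>The eikonal equation is rewritten with \<open>A\<close>, which has a two-sided
  derivative at \<open>r x\<close> even where \<open>r x\<close> is an extreme value of
  \<open>r\<close>.\<close>

lemma hessian_gradient:
  assumes "x \<in> M" "x \<in> chart_dom N i"
  shows "hessian N r i x (gradient N r i x) (gradient N r i x) = deriv A (r x) * \<alpha> (r x) / 2"
proof -
  have y: "chart N i x \<in> overlap i i" using assms by (auto simp: overlap_def)
  have rx: "(r \<circ> cinv N i) (chart N i x) = r x" using cinv_chart[OF riem assms(2)] by simp
  have "(A has_real_derivative deriv A (r x)) (at ((r \<circ> cinv N i) (chart N i x)))"
    unfolding rx using UA(1) by (intro smooth_on_has_real_derivative[OF UA(2)]) auto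
  moreover have "(let X = sharp (metric N i p) (frechet_derivative (r \<circ> cinv N i) (at p)) in metric N i p X X)
     = A ((r \<circ> cinv N i) p)" if "p \<in> overlap i i" for p
    using eikonal(1)[OF cinv_overlap(2)[OF that]] cinv_overlap(4)[OF that]
    by (simp add: gradient_def Let_def UA(3))
  ultimately show ?thesis
    using hessian_gradient_gradient[OF metric_on_overlap y smooth_on_r, of A] eikonal(1)[OF assms(2)]
    by (simp add: hessian_def christoffel_eq_sharp_koszul gradient_def)
qed

end

section \<open>Geometry of a shifted graph at one point\<close>

text \<open>The charts \<open>i\<close> and \<open>j\<close> vary independently, as in the
  definition of the flow, and the shift \<open>c\<close> lets one computation serve the initial
  graph and all its translates.\<close>

locale isoparametric_graph_point = isoparametric_graph N r \<alpha> \<beta> M UA UW A W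
  for N :: "('i, 'a::{t2_space, second_countable_topology}, 'e::euclidean_space) riem"
    and r \<alpha> \<beta> M UA UW A W +
  fixes i j :: 'i and x :: 'a and f :: "'a \<Rightarrow> 'a \<times> real" and c :: real
  assumes x: "x \<in> M" "x \<in> chart_dom N i" "x \<in> chart_dom N j"
    and f: "\<And>x. x \<in> M \<Longrightarrow> f x = (x, W (r x) + c)"
begin

abbreviation "y \<equiv> chart N i x"
abbreviation "\<rho> \<equiv> r \<circ> cinv N i"
abbreviation "\<tau> \<equiv> transition N i j"
abbreviation "dr \<equiv> frechet_derivative \<rho> (at y)"
abbreviation "d\<tau> \<equiv> frechet_derivative \<tau> (at y)"
abbreviation "ambient_metric \<equiv> metric (prod_line N) j (chart (prod_line N) j (f x))"
abbreviation "df \<equiv> differential N (prod_line N) f i j x"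

lemma y: "y \<in> overlap i j"
  using x by (auto simp: overlap_def)

lemma \<rho>_y: "\<rho> y = r x"
  using cinv_chart[OF riem x(2)] by simp

lemma \<tau>_y: "\<tau> y = chart N j x"
  using cinv_chart[OF riem x(2)] by (simp add: transition_def)

lemma linear_dr: "linear dr" and linear_d\<tau>: "linear d\<tau>"
  using smooth_on_has_derivative[OF smooth_on_r y] smooth_on_has_derivative[OF smooth_on_transition y]
  by (auto intro: has_derivative_linear)

lemma local_rep_overlap:
  assumes "p \<in> overlap i j"
  shows "local_rep N (prod_line N) f i j p = (\<tau> p, W (\<rho> p) + c)"
  using cinv_overlap[OF assms] by (simp add: local_rep_def f transition_def)

lemma height_has_derivative:
  "frechet_derivative (\<lambda>p. W (\<rho> p)) (at y) = (\<lambda>v. deriv W (r x) * dr v)"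
proof -
  have "\<rho> y \<in> UW" unfolding \<rho>_y using x UW(2) by auto
  from frechet_derivative_at[OF compose_real_has_derivative[OF smooth_on_r UW(3) y this]]
  show ?thesis by (simp only: \<rho>_y)
qed

lemma differential_graph: "df = (\<lambda>v. (d\<tau> v, deriv W (r x) * dr v))"
  using has_derivative_Pair_dir_deriv2(1)[OF open_overlap smooth_on_transition smooth_on_height y
      local_rep_overlap]
  by (simp only: differential_def height_has_derivative)

lemma ambient_metric_simp:
  "ambient_metric (v, a) (w, b) = metric N j (chart N j x) v w + a * b"
  by (simp add: f x)

lemma inner_product_ambient: "inner_product ambient_metric"
  using x by (simp add: f inner_product_prod_line riemannian_manifoldD(6)[OF riem])

lemma linear_df: "linear df"
  unfolding differential_graph
  by (auto intro!: linearI simp: linear_add[OF linear_dr] linear_add[OF linear_d\<tau>]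
      linear_cmul[OF linear_dr] linear_cmul[OF linear_d\<tau>] algebra_simps)

lemma d\<tau>_eq_0: "v = 0" if "d\<tau> v = 0"
proof -
  have "inner_product (metric N j (chart N j x))"
    using x by (intro riemannian_manifoldD(6)[OF riem]) auto
  then have "metric N j (chart N j x) 0 0 = 0" by (simp add: inner_product_zero_iff)
  then have "metric N i y v v = 0"
    using transition_isometry[OF y, of v v] that \<tau>_y by simp
  then show ?thesis
    by (simp only: inner_product_zero_iff[OF metric_on_inner_product[OF metric_on_overlap y]])
qed

lemma inj_df: "inj df"
proof -
  have "v = 0" if "df v = 0" for v
    using that d\<tau>_eq_0 by (simp add: differential_graph zero_prod_def)
  then show ?thesis using linear_df by (simp add: linear_injective_0)
qed

text \<open>A tangent vector of the graph with zero horizontal part is zero, so the vertical field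
  is nowhere tangent. This permits cancelling \<nu> from the soliton condition.\<close>

lemma normal_component_vertical: "normal_component N (prod_line N) f i j x (0, 1) \<noteq> 0"
proof
  assume "normal_component N (prod_line N) f i j x (0, 1) = 0"
  then obtain v where v: "(0, 1) = df v"
    unfolding normal_component_def
    using normal_part_eq_0_iff[OF inner_product_ambient linear_df inj_df] by auto
  then have "d\<tau> v = 0" "deriv W (r x) * dr v = 1" by (simp_all add: differential_graph)
  then show False using d\<tau>_eq_0[of v] linear_0[OF linear_dr] by simp
qed

lemma induced_metric_graph:
  "induced_metric N (prod_line N) f i j x
    = (\<lambda>v w. metric N i y v w + (deriv W (r x) * dr v) * (deriv W (r x) * dr w))"
  unfolding induced_metric_def[abs_def] differential_graph ambient_metric_simp
    transition_isometry[OF y] \<tau>_y by (rule refl)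

text \<open>The horizontal part of the ambient acceleration is \<open>d\<tau>(\<Gamma>\<^sub>i(v, w))\<close>, so up to a vector tangent
  to the graph only the vertical component, the Hessian of \<open>W \<circ> r\<close>, remains.\<close>

lemma second_fundamental_form_graph:
  "second_fundamental_form N (prod_line N) f i j x v w
    = (deriv (deriv W) (r x) * (dr v * dr w) + deriv W (r x) * hessian N r i x v w)
      *\<^sub>R normal_component N (prod_line N) f i j x (0, 1)"
proof -
  let ?\<Gamma> = "christoffel N i y v w"
  have image: "\<tau> ` overlap i j \<subseteq> chart N j ` chart_dom N j"
    using cinv_overlap(3) by (auto simp: transition_def)
  have horizontal: "dir_deriv2 \<tau> y v w + christoffel N j (chart N j x) (d\<tau> v) (d\<tau> w) = d\<tau> ?\<Gamma>"
    using sharp_koszul_transform[OF metric_on_overlap metric_on_chart[OF riem] y smooth_on_transition image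
        transition_isometry, of v w]
    by (simp add: christoffel_eq_sharp_koszul \<tau>_y)
  have chr: "christoffel (prod_line N) j (chart (prod_line N) j (f x)) (df v) (df w)
      = (christoffel N j (chart N j x) (d\<tau> v) (d\<tau> w), 0)"
    using x by (simp add: f differential_graph christoffel_prod_line[OF riem])
  have dd: "dir_deriv2 (local_rep N (prod_line N) f i j) y v w
      = (dir_deriv2 \<tau> y v w, dir_deriv2 (\<lambda>p. W (\<rho> p)) y v w)"
    by (rule has_derivative_Pair_dir_deriv2(2)[OF open_overlap smooth_on_transition smooth_on_height y
          local_rep_overlap])
  have "dir_deriv2 (\<lambda>p. W (\<rho> p)) y v w
      = deriv (deriv W) (r x) * (dr v * dr w) + deriv W (r x) * dir_deriv2 \<rho> y v w"
    using dir_deriv2_compose_real[OF open_overlap smooth_on_r UW(1,3) r_overlap y, of v w]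
    by (simp only: \<rho>_y)
  then have "dir_deriv2 (local_rep N (prod_line N) f i j) y v w
      + christoffel (prod_line N) j (chart (prod_line N) j (f x)) (df v) (df w)
    = (deriv (deriv W) (r x) * (dr v * dr w) + deriv W (r x) * hessian N r i x v w) *\<^sub>R (0, 1) + df ?\<Gamma>"
    unfolding dd chr using horizontal
    by (simp add: differential_graph hessian_def algebra_simps)
  then show ?thesis
    unfolding second_fundamental_form_def normal_component_def
    by (simp only: normal_part_scale_add_range[OF inner_product_ambient linear_df inj_df])
qed

text \<open>The second fundamental form is a scalar form times one fixed vector, so the trace acts
  on the scalar form, where the rank one formula applies.\<close>

lemma mean_curvature_vector_graph:
  "mean_curvature_vector N (prod_line N) f i j x
    = curvature_coeff (r x)
      *\<^sub>R normal_component N (prod_line N) f i j x (0, 1)"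
proof -
  let ?B = "\<lambda>v w. deriv (deriv W) (r x) * (dr v * dr w) + deriv W (r x) * hessian N r i x v w"
  have "second_fundamental_form N (prod_line N) f i j x
      = (\<lambda>v w. ?B v w *\<^sub>R normal_component N (prod_line N) f i j x (0, 1))"
    by (intro ext) (rule second_fundamental_form_graph)
  then have "mean_curvature_vector N (prod_line N) f i j x
      = metric_trace (induced_metric N (prod_line N) f i j x) ?B
        *\<^sub>R normal_component N (prod_line N) f i j x (0, 1)"
    by (simp add: mean_curvature_vector_def metric_trace_def scaleR_sum_left)
  moreover have "metric_trace (induced_metric N (prod_line N) f i j x) ?B
      = curvature_coeff (r x)"
    unfolding induced_metric_graph
      metric_trace_graph[OF metric_on_inner_product[OF metric_on_overlap y] linear_dr bilinear_hessian[OF x(1,2)]]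
    using eikonal[OF x(2)] hessian_gradient[OF x(1,2)]
    by (simp add: curvature_coeff_def Let_def gradient_def laplacian_def)
  ultimately show ?thesis by simp
qed

end

section \<open>The differential equation and the curvature coefficient\<close>

context isoparametric_graph
begin

lemma nonneg_\<alpha>: "0 \<le> \<alpha> (r x)"
proof -
  obtain i where i: "x \<in> chart_dom N i" using riemannian_manifoldD(1)[OF riem] by blast
  then have "inner_product (metric N i (chart N i x))"
    by (intro riemannian_manifoldD(6)[OF riem]) simp
  from inner_product_nonneg[OF this] show ?thesis by (simp only: eikonal(1)[OF i, symmetric])
qed

text \<open>On the open set \<open>M\<close> all derivatives of a constant vanish. This settles the
  case in which the image of \<open>M\<close> is one point and \<open>deriv_on\<close> carries no
  information.\<close>

lemma \<alpha>_\<beta>_eq_0_if_constant: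
  assumes const: "\<And>x. x \<in> M \<Longrightarrow> r x = k" and x: "x \<in> M"
  shows "\<alpha> (r x) = 0" "\<beta> (r x) = 0"
proof -
  obtain i where i: "x \<in> chart_dom N i" using riemannian_manifoldD(1)[OF riem] by blast
  let ?y = "chart N i x" and ?\<rho> = "r \<circ> cinv N i"
  have y: "?y \<in> overlap i i" using x i by (auto simp: overlap_def)
  have ip: "inner_product (metric N i ?y)" by (rule metric_on_inner_product[OF metric_on_overlap y])
  have d: "frechet_derivative ?\<rho> (at p) = (\<lambda>v. 0)" if "p \<in> overlap i i" for p
  proof -
    have "(?\<rho> has_derivative (\<lambda>v. 0)) (at p)"
      using has_derivative_const[of k "at p"] open_overlap that
      by (rule has_derivative_transform_within_open) (simp add: const cinv_overlap)
    from frechet_derivative_at[OF this] show ?thesis by (rule sym)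
  qed
  have dd: "dir_deriv2 ?\<rho> ?y v w = 0" for v w
  proof -
    have "((\<lambda>z. frechet_derivative ?\<rho> (at z) w) has_derivative (\<lambda>v. 0)) (at ?y)"
      using has_derivative_const[of 0 "at ?y"] open_overlap y
      by (rule has_derivative_transform_within_open) (simp add: d)
    from frechet_derivative_at[OF this] show ?thesis
      unfolding dir_deriv2_def by (simp add: fun_eq_iff)
  qed
  have "gradient N r i x = 0"
    unfolding gradient_def d[OF y]
    by (rule sharp_unique[OF ip]) (simp add: linear_0[OF inner_product_linear(2)[OF ip]])
  then show "\<alpha> (r x) = 0"
    using eikonal(1)[OF i] linear_0[OF inner_product_linear(2)[OF ip]] by simp
  have "hessian N r i x v w = 0" for v w
    by (simp add: hessian_def dd d[OF y])
  then show "\<beta> (r x) = 0"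
    using eikonal(2)[OF i] by (simp add: laplacian_def metric_trace_def)
qed

lemma soliton_equation_iff:
  assumes "connected M" and V: "\<And>s. s \<in> r ` M \<Longrightarrow> W s = V s"
  shows "soliton_equation (r ` M) \<alpha> \<beta> V \<longleftrightarrow> (\<forall>x\<in>M. curvature_coeff (r x) = 1)"
proof (cases "\<exists>k. r ` M = {k}")
  case True
  then obtain k where k: "r ` M = {k}" ..
  then have const: "r x = k" if "x \<in> M" for x using that by auto
  obtain x0 where "x0 \<in> M" using k by auto
  then have "\<alpha> k = 0" "\<beta> k = 0"
    using \<alpha>_\<beta>_eq_0_if_constant[OF const, of x0] const[of x0] by simp_all
  \<comment> \<open>Whatever values \<open>deriv_on\<close> takes here, they are multiplied by 0:
    the equation reads -2 = 0 and the coefficient is 0.\<close>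
  then have "\<not> soliton_equation (r ` M) \<alpha> \<beta> V" "curvature_coeff (r x0) \<noteq> 1"
    using k \<open>x0 \<in> M\<close> const[of x0] by (auto simp: soliton_equation_def curvature_coeff_def)
  then show ?thesis using \<open>x0 \<in> M\<close> by auto
next
  case False
  have "continuous_on M r"
    using continuous_on_smooth_fun[OF riem smooth_fun_r] by (rule continuous_on_subset) simp
  then have "connected (r ` M)" using assms(1) by (rule connected_continuous_image)
  \<comment> \<open>A connected set that is not a single point accumulates at each of its
    points.\<close>
  then have lim: "s islimpt r ` M" if "s \<in> r ` M" for s
    using that by (rule connected_imp_perfect) (use False in simp)
  have UW_s: "s \<in> UW" if "s \<in> r ` M" for s using that UW(2) by blast
  have V1: "deriv_on (r ` M) V s = deriv W s" if s: "s \<in> r ` M" for s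
    using V[symmetric] smooth_on_has_real_derivative[OF UW(3) UW_s[OF s]] by (rule deriv_on_eq[OF lim[OF s] s])
  \<comment> \<open>\<open>V1\<close> says that \<open>deriv W\<close> extends
    \<open>deriv_on\<close> of \<open>V\<close>, so the same comparison applies once more.\<close>
  have V2: "deriv_on (r ` M) (deriv_on (r ` M) V) s = deriv (deriv W) s" if s: "s \<in> r ` M" for s
    using V1 smooth_on_has_real_derivative[OF smooth_on_deriv[OF UW(1,3)] UW_s[OF s]]
    by (rule deriv_on_eq[OF lim[OF s] s])
  have \<alpha>1: "deriv_on (r ` M) \<alpha> s = deriv A s" if s: "s \<in> r ` M" for s
  proof (rule deriv_on_eq[OF lim[OF s] s])
    show "\<alpha> t = A t" if "t \<in> r ` M" for t using UA(3)[of t] that by auto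
    show "(A has_real_derivative deriv A s) (at s)"
      using s UA(1) by (intro smooth_on_has_real_derivative[OF UA(2)]) auto
  qed
  have "curvature_coeff (r x) = 1 \<longleftrightarrow>
      2 * \<alpha> (r x) * deriv_on (r ` M) (deriv_on (r ` M) V) (r x)
        - \<alpha> (r x) * (deriv_on (r ` M) \<alpha> (r x) - 2 * \<beta> (r x)) * deriv_on (r ` M) V (r x) ^ 3
        - 2 * \<alpha> (r x) * deriv_on (r ` M) V (r x) ^ 2
        + 2 * \<beta> (r x) * deriv_on (r ` M) V (r x) - 2 = 0" if "x \<in> M" for x
  proof -
    have s: "r x \<in> r ` M" using that by simp
    show ?thesis
      unfolding V1[OF s] V2[OF s] \<alpha>1[OF s] curvature_coeff_def Let_def
      by (rule soliton_equation_algebra[OF nonneg_\<alpha>])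
  qed
  then show ?thesis by (simp add: soliton_equation_def)
qed

end

section \<open>Velocities and translating solitons\<close>

context isoparametric_graph_point
begin

lemma normal_component_simps:
  "normal_component N (prod_line N) f i j x 0 = 0"
  "normal_component N (prod_line N) f i j x (w - w')
    = normal_component N (prod_line N) f i j x w - normal_component N (prod_line N) f i j x w'"
  unfolding normal_component_def
  using linear_0[OF linear_df] normal_part_diff[OF inner_product_ambient linear_df inj_df]
  by (auto simp: normal_part_eq_0_iff[OF inner_product_ambient linear_df inj_df] image_iff intro!: exI[of _ 0])

end

lemma inv_vertical_translation: "inv (vertical_translation t) = (\<lambda>(x, s). (x, s - t))"
  by (rule inv_equality) (auto simp: vertical_translation_def)

text \<open>\<open>vector_derivative\<close> is a choice operator; joint smoothness in time and
  position, restricted to a line of constant position, shows that it is a genuine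
  derivative.\<close>

lemma smooth_family_velocity:
  assumes "smooth_family_of_immersions N M P I f" "t \<in> I" "x \<in> M" "x \<in> chart_dom N i"
    "f t x \<in> chart_dom P j" "cinv N i (chart N i x) = x"
  shows "((\<lambda>s. chart P j (f s x)) has_vector_derivative
    vector_derivative (\<lambda>s. chart P j (f s x)) (at t)) (at t)"
proof -
  let ?F = "\<lambda>(t, y). local_rep N P (f t) i j y"
  have "smooth_on {(t, chart N i x) | t x. t \<in> I \<and> x \<in> M \<inter> chart_dom N i \<and> f t x \<in> chart_dom P j} ?F"
    using assms(1) unfolding smooth_family_of_immersions_def by simp
  then have "(?F has_derivative frechet_derivative ?F (at (t, chart N i x))) (at (t, chart N i x))"
    by (rule smooth_on_has_derivative) (use assms in auto)
  moreover have "((\<lambda>s. (s, chart N i x)) has_derivative (\<lambda>h. (h, 0))) (at t)"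
    by (intro has_derivative_Pair has_derivative_ident has_derivative_const)
  ultimately have "((\<lambda>s. ?F (s, chart N i x)) has_derivative
      (\<lambda>h. frechet_derivative ?F (at (t, chart N i x)) (h, 0))) (at t)"
    by (rule has_derivative_compose[rotated])
  then have "(\<lambda>s. chart P j (f s x)) differentiable (at t)"
    using assms(6) by (intro differentiableI) (simp add: local_rep_def)
  then show ?thesis by (simp only: vector_derivative_works)
qed

text \<open>Time enters additively and \<tau> and \<open>h\<close> are pulled back along the linear
  projection \<open>snd\<close>, so closure under linear inner maps is enough.\<close>

lemma smooth_on_translated_graph:
  fixes \<tau> :: "'e::real_normed_vector \<Rightarrow> 'e" and h :: "'e \<Rightarrow> real"
  assumes "open D" "smooth_on D \<tau>" "smooth_on D h"
  shows "smooth_on (UNIV \<times> D) (\<lambda>(t, p). (\<tau> p, h p + t))"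
  unfolding smooth_on_def
proof
  fix k
  have o: "open ((UNIV :: real set) \<times> D)" using assms(1) by (intro open_Times) auto
  have snd: "snd ` ((UNIV :: real set) \<times> D) \<subseteq> D" by auto
  have "Ck_on k ((UNIV :: real set) \<times> D) (\<lambda>q. (\<tau> (snd q), h (snd q) + fst q))"
  proof (intro Ck_on_Pair[OF o] Ck_on_add[OF o])
    show "Ck_on k ((UNIV :: real set) \<times> D) (\<lambda>q. \<tau> (snd q))"
      using assms(2) by (intro Ck_on_compose_linear[OF o assms(1) bounded_linear_snd snd]) (simp add: smooth_on_def)
    show "Ck_on k ((UNIV :: real set) \<times> D) (\<lambda>q. h (snd q))"
      using assms(3) by (intro Ck_on_compose_linear[OF o assms(1) bounded_linear_snd snd]) (simp add: smooth_on_def)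
    show "Ck_on k ((UNIV :: real set) \<times> D) fst"
      by (rule Ck_on_bounded_linear[OF o bounded_linear_fst])
  qed
  then show "Ck_on k ((UNIV :: real set) \<times> D) (\<lambda>(t, p). (\<tau> p, h p + t))"
    by (simp add: case_prod_unfold)
qed

context isoparametric_graph
begin

lemma graph_point:
  assumes "x \<in> M" "x \<in> chart_dom N i" "x \<in> chart_dom N j" "\<And>x. x \<in> M \<Longrightarrow> f x = (x, W (r x) + c)"
  shows "isoparametric_graph_point N r \<alpha> \<beta> M UA UW A W i j x f c"
  by unfold_locales (use assms in auto)

text \<open>At time 0 the immersion is known to be the graph, so its mean curvature is explicit; at
  other times the flow may also move points tangentially.\<close>

lemma curvature_coeff_eq_1_if_soliton:
  assumes soliton: "translating_soliton N M u I f" and u: "\<And>x. x \<in> M \<Longrightarrow> u x = W (r x)"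
    and "x \<in> M"
  shows "curvature_coeff (r x) = 1"
proof -
  obtain i where i: "x \<in> chart_dom N i" using riemannian_manifoldD(1)[OF riem] by blast
  let ?P = "prod_line N"
  define g where "g = (\<lambda>t. inv (vertical_translation t) \<circ> f t)"
  have f0: "f 0 x = (x, W (r x) + 0)" if "x \<in> M" for x
    using soliton u that by (simp add: translating_soliton_def)
  interpret isoparametric_graph_point N r \<alpha> \<beta> M UA UW A W i i x "f 0" 0
    using \<open>x \<in> M\<close> i i f0 by (rule graph_point)
  have dom: "f 0 x \<in> chart_dom ?P i" using f0[OF \<open>x \<in> M\<close>] i by simp
  \<comment> \<open>At time 0 the flow and its pullback by the translations are the same immersion,
    so both normal components are taken with the same projection.\<close>
  have g0: "g 0 = f 0"
    by (auto simp: g_def inv_vertical_translation)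
  have flow: "mean_curvature_flow N M ?P I f" and "0 \<in> I"
    using soliton by (auto simp: translating_soliton_def mean_curvature_flow_def)
  have H: "normal_velocity N ?P f 0 i i x = mean_curvature_vector N ?P (f 0) i i x"
    using flow \<open>x \<in> M\<close> i dom \<open>0 \<in> I\<close> unfolding mean_curvature_flow_def by simp
  have G: "normal_velocity N ?P g 0 i i x = 0"
    using soliton \<open>x \<in> M\<close> i dom \<open>0 \<in> I\<close> g0
    unfolding translating_soliton_def Let_def g_def[symmetric] by simp
  let ?v = "vector_derivative (\<lambda>s. chart ?P i (f s x)) (at 0)"
  have "((\<lambda>s. chart ?P i (f s x)) has_vector_derivative ?v) (at 0)"
    using flow \<open>x \<in> M\<close> i dom \<open>0 \<in> I\<close> cinv_chart[OF riem i]
    by (intro smooth_family_velocity[where N = N and M = M and I = I and i = i]) (simp_all add: mean_curvature_flow_def)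
  moreover have "((\<lambda>s::real. (0::'e, s)) has_vector_derivative (0, 1)) (at 0)"
    by (intro has_vector_derivative_Pair has_vector_derivative_const has_vector_derivative_id)
  ultimately have "((\<lambda>s. chart ?P i (f s x) - (0, s)) has_vector_derivative (?v - (0, 1))) (at 0)"
    by (rule has_vector_derivative_diff)
  \<comment> \<open>In a product chart the inverse translation subtracts \<open>(0, s)\<close>, so
    the velocities differ by \<open>(0, 1)\<close>.\<close>
  moreover have "chart ?P i (g s x) = chart ?P i (f s x) - (0, s)" for s
    by (cases "f s x") (simp add: g_def inv_vertical_translation)
  ultimately have "vector_derivative (\<lambda>s. chart ?P i (g s x)) (at 0) = ?v - (0, 1)"
    by (simp add: vector_derivative_at)
  then have "normal_component N ?P (f 0) i i x ?v = normal_component N ?P (f 0) i i x (0, 1)"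
    using G by (simp add: normal_velocity_def g0 normal_component_simps)
  then have "curvature_coeff (r x) *\<^sub>R normal_component N ?P (f 0) i i x (0, 1)
      = 1 *\<^sub>R normal_component N ?P (f 0) i i x (0, 1)"
    using H mean_curvature_vector_graph by (simp add: normal_velocity_def)
  then show ?thesis
    using normal_component_vertical by (simp only: scaleR_cancel_right) simp
qed

lemma graph_chart_image:
  "{x \<in> M \<inter> chart_dom N i. (x, s x) \<in> chart_dom (prod_line N) j} = M \<inter> chart_dom N i \<inter> chart_dom N j"
  by auto

context
  fixes u :: "'a \<Rightarrow> real"
  assumes u: "\<And>x. x \<in> M \<Longrightarrow> u x = W (r x)"
begin

text \<open>\<open>u\<close> agrees with \<open>W \<circ> r\<close> on \<open>M\<close> only, so
  local representatives are compared on the overlaps; openness of these transfers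
  smoothness.\<close>

lemma smooth_family_translated_graph:
  "smooth_family_of_immersions N M (prod_line N) UNIV (\<lambda>t x. (x, u x + t))"
proof -
  let ?P = "prod_line N" and ?f = "\<lambda>t x. (x, u x + t)"
  have "continuous_on M r"
    using continuous_on_smooth_fun[OF riem smooth_fun_r] by (rule continuous_on_subset) simp
  with smooth_on_continuous_on[OF UW(3)] have "continuous_on M (\<lambda>x. W (r x))"
    using UW(2) by (rule continuous_on_compose2)
  then have cont: "continuous_on M u"
    by (rule continuous_on_eq) (simp add: u)
  have rep: "local_rep N ?P (?f t) i j p = (transition N i j p, W ((r \<circ> cinv N i) p) + t)"
    if "p \<in> overlap i j" for t i j p
    using cinv_overlap(1)[OF that] by (simp add: local_rep_def transition_def u)
  have "immersion N M ?P (?f t)" for t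
    unfolding immersion_def
  proof (intro conjI allI ballI impI)
    show "continuous_on M (?f t)"
      by (intro continuous_intros cont)
    show "smooth_on (chart N i ` {x \<in> M \<inter> chart_dom N i. ?f t x \<in> chart_dom ?P j}) (local_rep N ?P (?f t) i j)"
      for i j
    proof -
      have "smooth_on (overlap i j) (\<lambda>p. (transition N i j p, W ((r \<circ> cinv N i) p) + t))"
        unfolding smooth_on_def
      proof
        fix k
        show "Ck_on k (overlap i j) (\<lambda>p. (transition N i j p, W ((r \<circ> cinv N i) p) + t))"
          using smooth_on_transition[of i j] smooth_on_height[of i j] unfolding smooth_on_def
          by (intro Ck_on_Pair[OF open_overlap] Ck_on_add[OF open_overlap] Ck_on_const[OF open_overlap])
            (erule spec)+
      qed
      with open_overlap have "smooth_on (overlap i j) (local_rep N ?P (?f t) i j)"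
        by (rule smooth_on_cong) (rule rep[symmetric])
      then show ?thesis
        unfolding graph_chart_image overlap_def .
    qed
    show "inj (differential N ?P (?f t) i j x)" if "x \<in> M \<inter> chart_dom N i" "?f t x \<in> chart_dom ?P j" for i j x
    proof -
      interpret isoparametric_graph_point N r \<alpha> \<beta> M UA UW A W i j x "?f t" t
        using that u by (intro graph_point) auto
      show ?thesis by (rule inj_df)
    qed
  qed
  moreover have "continuous_on (UNIV \<times> M) (\<lambda>(t, x). ?f t x)"
    unfolding case_prod_unfold
    by (intro continuous_intros continuous_on_compose2[OF cont]) auto
  moreover have "smooth_on {(t, chart N i x) | t x. t \<in> UNIV \<and> x \<in> M \<inter> chart_dom N i \<and> ?f t x \<in> chart_dom ?P j}
      (\<lambda>(t, y). local_rep N ?P (?f t) i j y)" for i j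
  proof -
    have "{(t, chart N i x) | t x. t \<in> UNIV \<and> x \<in> M \<inter> chart_dom N i \<and> ?f t x \<in> chart_dom ?P j}
      = UNIV \<times> overlap i j" by (auto simp: overlap_def)
    moreover have "smooth_on (UNIV \<times> overlap i j) (\<lambda>(t, y). local_rep N ?P (?f t) i j y)"
      using open_Times[OF open_UNIV open_overlap]
        smooth_on_translated_graph[OF open_overlap smooth_on_transition smooth_on_height]
      by (rule smooth_on_cong) (auto simp: rep)
    ultimately show ?thesis by (simp only:)
  qed
  ultimately show ?thesis
    unfolding smooth_family_of_immersions_def by blast
qed

text \<open>The velocity is the vertical unit field, with normal component \<nu>, and a coefficient
  equal to 1 makes \<nu> the mean curvature vector at every time.\<close>

lemma translating_soliton_graph:
  assumes coeff: "\<And>x. x \<in> M \<Longrightarrow> curvature_coeff (r x) = 1"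
  shows "translating_soliton N M u UNIV (\<lambda>t x. (x, u x + t))"
proof -
  let ?P = "prod_line N" and ?f = "\<lambda>t x. (x, u x + t)"
  have "mean_curvature_flow N M ?P UNIV ?f"
    unfolding mean_curvature_flow_def
  proof (intro conjI ballI allI impI smooth_family_translated_graph)
    fix t i j x assume x: "x \<in> M \<inter> chart_dom N i" "?f t x \<in> chart_dom ?P j"
    interpret isoparametric_graph_point N r \<alpha> \<beta> M UA UW A W i j x "?f t" t
      using x u by (intro graph_point) auto
    have "((\<lambda>s. (chart N j x, u x + s)) has_vector_derivative (0, 0 + 1)) (at t)"
      by (intro has_vector_derivative_Pair has_vector_derivative_const has_vector_derivative_add
          has_vector_derivative_id)
    then have "vector_derivative (\<lambda>s. chart ?P j (?f s x)) (at t) = (0, 1)"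
      by (simp add: vector_derivative_at)
    then show "normal_velocity N ?P ?f t i j x = mean_curvature_vector N ?P (?f t) i j x"
      using coeff x by (simp add: normal_velocity_def mean_curvature_vector_graph)
  qed auto
  moreover have "normal_velocity N ?P (\<lambda>t. inv (vertical_translation t) \<circ> ?f t) t i j x = 0"
    if x: "x \<in> M \<inter> chart_dom N i" "(inv (vertical_translation t) \<circ> ?f t) x \<in> chart_dom ?P j" for t i j x
  proof -
    \<comment> \<open>Undoing the translations leaves a family that does not depend on time, whose
      velocity is 0.\<close>
    have g: "inv (vertical_translation t) \<circ> ?f t = (\<lambda>x. (x, u x))" for t
      by (auto simp: inv_vertical_translation)
    interpret isoparametric_graph_point N r \<alpha> \<beta> M UA UW A W i j x "\<lambda>x. (x, u x)" 0
      using x u unfolding g by (intro graph_point) auto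
    show ?thesis
      unfolding normal_velocity_def g by (simp add: normal_component_simps)
  qed
  ultimately show ?thesis
    by (simp add: translating_soliton_def)
qed

end

end

theorem lemma2p5:
  fixes N :: "('i, 'a::{t2_space, second_countable_topology}, 'e::euclidean_space) riem"
    and r :: "'a \<Rightarrow> real" and \<alpha> \<beta> :: "real \<Rightarrow> real" and M :: "'a set"
  assumes "riemannian_manifold N"
    and "isoparametric N r \<alpha> \<beta>"
    and "open M" and "connected M" and "M \<noteq> {}"
  shows "(\<forall>(u :: 'a \<Rightarrow> real) I f V.
            translating_soliton N M u I f \<and> smooth_on_set (r ` M) V \<and> (\<forall>x\<in>M. u x = V (r x))
            \<longrightarrow> soliton_equation (r ` M) \<alpha> \<beta> V)
       \<and> (\<forall>V. smooth_on_set (r ` M) V \<and> soliton_equation (r ` M) \<alpha> \<beta> V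
            \<longrightarrow> translating_soliton N M (V \<circ> r) UNIV (\<lambda>t x. (x, (V \<circ> r) x + t)))"
proof -
  have "smooth_on_set (range r) \<alpha>" using assms(2) by (simp add: isoparametric_def)
  then obtain UA A where A: "range r \<subseteq> UA" "smooth_on UA A" "\<forall>s\<in>range r. A s = \<alpha> s"
    unfolding smooth_on_set_def by auto
  \<comment> \<open>The extension \<open>A\<close> of \<alpha> is fixed once; each \<open>V\<close>
    brings its own extension \<open>W\<close>, defined near the image of \<open>M\<close>.\<close>
  have graph: "\<exists>UW W. isoparametric_graph N r \<alpha> \<beta> M UA UW A W \<and> (\<forall>s\<in>r ` M. W s = V s)"
    if "smooth_on_set (r ` M) V" for V
  proof -
    from that obtain UW W where "open UW \<and> r ` M \<subseteq> UW \<and> smooth_on UW W \<and> (\<forall>s\<in>r ` M. W s = V s)"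
      unfolding smooth_on_set_def by (elim exE)
    then have W: "open UW" "r ` M \<subseteq> UW" "smooth_on UW W" "\<forall>s\<in>r ` M. W s = V s" by simp_all
    have "isoparametric_graph N r \<alpha> \<beta> M UA UW A W"
      by unfold_locales (fact assms A(1,2) W bspec[OF A(3)])+
    with W(4) show ?thesis by auto
  qed
  show ?thesis
  proof (intro conjI allI impI; elim conjE)
    fix u I f V
    assume soliton: "translating_soliton N M u I f" and V: "smooth_on_set (r ` M) V"
      and u: "\<forall>x\<in>M. u x = V (r x)"
    obtain UW W where graph': "isoparametric_graph N r \<alpha> \<beta> M UA UW A W" and W: "\<forall>s\<in>r ` M. W s = V s"
      using graph[OF V] by auto
    interpret isoparametric_graph N r \<alpha> \<beta> M UA UW A W by (rule graph')
    show "soliton_equation (r ` M) \<alpha> \<beta> V"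
      using curvature_coeff_eq_1_if_soliton[OF soliton] u W
      by (subst soliton_equation_iff[OF assms(4)]) auto
  next
    fix V
    assume V: "smooth_on_set (r ` M) V" and eq: "soliton_equation (r ` M) \<alpha> \<beta> V"
    obtain UW W where graph': "isoparametric_graph N r \<alpha> \<beta> M UA UW A W" and W: "\<forall>s\<in>r ` M. W s = V s"
      using graph[OF V] by auto
    interpret isoparametric_graph N r \<alpha> \<beta> M UA UW A W by (rule graph')
    have "\<forall>x\<in>M. curvature_coeff (r x) = 1"
      using eq W by (subst soliton_equation_iff[OF assms(4), of V, symmetric]) auto
    then show "translating_soliton N M (V \<circ> r) UNIV (\<lambda>t x. (x, (V \<circ> r) x + t))"
      using W by (intro translating_soliton_graph) auto
  qed
qed

end
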